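(* Let $k \geq 2$ be an integer. There is no non-diregular $k$-geodetic digraph with minimum out-degree at least $2$ and order $M(2,k)+2$, where $M(2,k) = 1+2+2^2+\dots+2^k$.
   Context: A digraph is $k$-geodetic if for any two vertices $u,v$ there is at most one directed walk from $u$ to $v$ of length at most $k$. A digraph is diregular if there is $d$ with $d^-(u)=d^+(u)=d$ for all vertices $u$. A $k$-geodetic digraph with minimum out-degree $\geq d$ and order $M(d,k)+\epsilon$, where $M(d,k)=1+d+\dots+d^k$, is called a $(d,k,+\epsilon)$-digraph (a digraph with excess $\epsilon$); the claim says there are no non-diregular $(2,k,+2)$-digraphs. *)

theory Defs
  imports "Graph_Theory.Arc_Walk"
begin

text \<open>
  Walks are arc sequences. A loop at u, or two parallel arcs from u to v, yields two distinct
  walks of length at most 1 with the same ends; so for k \<ge> 1 a k-geodetic digraph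
  has no loops or multiple arcs, and these need not be excluded separately.
\<close>

definition k_geodetic :: "nat \<Rightarrow> ('a, 'b) pre_digraph \<Rightarrow> bool" where
  "k_geodetic k G \<longleftrightarrow>
    (\<forall>u\<in>verts G. \<forall>v\<in>verts G. \<forall>p q.
      pre_digraph.awalk G u p v \<and> length p \<le> k \<and>
      pre_digraph.awalk G u q v \<and> length q \<le> k \<longrightarrow> p = q)"

definition diregular :: "('a, 'b) pre_digraph \<Rightarrow> bool" where
  "diregular G \<longleftrightarrow>
    (\<exists>d. \<forall>u\<in>verts G. in_degree G u = d \<and> out_degree G u = d)"

definition moore_bound :: "nat \<Rightarrow> nat \<Rightarrow> nat" where
  "moore_bound d k = (\<Sum>i\<le>k. d ^ i)"

definition excess_digraph :: "nat \<Rightarrow> nat \<Rightarrow> nat \<Rightarrow> ('a, 'b) pre_digraph \<Rightarrow> bool" where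
  "excess_digraph d k \<epsilon> G \<longleftrightarrow>
    fin_digraph G \<and> k_geodetic k G \<and>
    (\<forall>u\<in>verts G. d \<le> out_degree G u) \<and>
    card (verts G) = moore_bound d k + \<epsilon>"

end

theory Submission
  imports Defs
begin

text \<open>
  Counting shows that all out-degrees equal 2. Writing A for the adjacency matrix and O for the
  0/1 matrix of outliers (v is an outlier of u if it is not reached from u in at most k steps),
  k-geodecity says I + A + ... + A^k = J - O. Since A commutes with the left-hand side, the
  outliers of the children of u are the children of the outliers of u, corrected by the defects
  2 - indegree(v); and the column sums of O are explicit sums of defects, whose nonnegativity
  forces each vertex of in-degree above 2 to lie just behind vertices of in-degree 1.

  The second ingredient is an alternation argument. If a, b are the children of u, the vertices at
  distance k from b split into two halves R1, R2 of size 2^(k-1), the vertices at distance k - 1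
  from either child of b, and no arc stays within a half. If b reached the whole out-tree of
  depth k - 1 of a, then the halves would alternate along its levels, but the alternating sum
  1 - 2 + 4 - ... of the level sizes is too large for R1 and R2 to have equal size (k > 2). So some
  outlier of b lies in the tree of a. Together with the counts this leaves only total positive
  defect 0 or 2. In the latter case the two vertices of in-degree 1 have the same children, and identifying them
  gives a k-geodetic digraph of excess 1; a vertex of in-degree 0 can be deleted with the same
  effect. Excess 1 is impossible: there the outlier map is an automorphism, and the alternating
  sums confine the outlier of b to distance at most 1 from a.

  For k = 2 the order is 9 and a search over all completions of the tree of depth 2 suffices.
\<close>

section \<open>Out-balls and counting walks\<close>

primrec out_ball :: "('a \<Rightarrow> 'a set) \<Rightarrow> nat \<Rightarrow> 'a \<Rightarrow> 'a set" where
  "out_ball N 0 u = {u}"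
| "out_ball N (Suc m) u = insert u (\<Union>v\<in>N u. out_ball N m v)"

lemma out_ball_self [simp]: "u \<in> out_ball N m u"
  by (cases m) auto

lemma out_ball_Suc_mono: "out_ball N m u \<subseteq> out_ball N (Suc m) u"
proof (induction m arbitrary: u)
  case (Suc m)
  show ?case using Suc.IH by auto
qed simp

lemma out_ball_mono: "m \<le> m' \<Longrightarrow> out_ball N m u \<subseteq> out_ball N m' u"
  by (rule lift_Suc_mono_le[of "\<lambda>m. out_ball N m u", OF out_ball_Suc_mono])

lemma in_ball_mono: "x \<in> out_ball N m u \<Longrightarrow> m \<le> m' \<Longrightarrow> x \<in> out_ball N m' u"
  by (rule subsetD[OF out_ball_mono])

lemma out_ball_step: "y \<in> out_ball N m u \<Longrightarrow> z \<in> N y \<Longrightarrow> z \<in> out_ball N (Suc m) u"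
  by (induction m arbitrary: u) auto

lemma card_2_obtain_other:
  assumes "card A = 2" "a \<in> A"
  obtains b where "A = {a, b}" "a \<noteq> b"
  using assms by (auto simp: card_2_iff doubleton_eq_iff)

declare out_ball.simps(2) [simp del]
lemmas out_ball_Suc = out_ball.simps(2)

text \<open>Geodecity is encoded by ball sizes: a ball of radius k with the full 2^(k+1) - 1
  vertices leaves no room for two walks of length at most k from u with a common end. In this form
  it is easy to check after the deletion or identification of vertices.\<close>

locale binary_geodetic =
  fixes V :: "'a set" and N :: "'a \<Rightarrow> 'a set" and k :: nat
  assumes finite_V: "finite V"
    and N_subset: "u \<in> V \<Longrightarrow> N u \<subseteq> V"
    and card_N: "u \<in> V \<Longrightarrow> card (N u) = 2"
    and card_ball_k: "u \<in> V \<Longrightarrow> card (out_ball N k u) = 2 ^ Suc k - 1"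
    and k_pos: "0 < k"
begin

abbreviation B :: "nat \<Rightarrow> 'a \<Rightarrow> 'a set" where
  "B \<equiv> out_ball N"

definition preds :: "'a \<Rightarrow> 'a set" where
  "preds v = {x \<in> V. v \<in> N x}"

definition outliers :: "'a \<Rightarrow> 'a set" where
  "outliers u = V - B k u"

lemma preds_iff: "x \<in> preds v \<longleftrightarrow> x \<in> V \<and> v \<in> N x"
  by (simp add: preds_def)

lemma outliers_iff: "v \<in> outliers u \<longleftrightarrow> v \<in> V \<and> v \<notin> B k u"
  by (simp add: outliers_def)

lemma finite_preds [simp]: "finite (preds v)"
  using finite_V by (simp add: preds_def)

lemma finite_outliers [simp]: "finite (outliers u)"
  using finite_V by (simp add: outliers_def)

lemma in_ball_pred: "x \<in> B m u \<Longrightarrow> m < k \<Longrightarrow> x \<in> B (k - 1) u"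
  by (erule in_ball_mono) simp

lemma finite_N: "u \<in> V \<Longrightarrow> finite (N u)"
  using card_N[of u] by (metis card.infinite zero_neq_numeral)

lemma N_in_V: "u \<in> V \<Longrightarrow> v \<in> N u \<Longrightarrow> v \<in> V"
  using N_subset by blast

lemma ball_subset_V: "u \<in> V \<Longrightarrow> B m u \<subseteq> V"
  by (induction m arbitrary: u) (auto simp: out_ball_Suc dest: N_in_V)

lemma finite_ball: "u \<in> V \<Longrightarrow> finite (B m u)"
  by (rule finite_subset[OF ball_subset_V finite_V])

lemma obtain_N:
  assumes "u \<in> V"
  obtains a b where "N u = {a, b}" "a \<noteq> b" "a \<in> V" "b \<in> V"
  using card_N[OF assms] N_subset[OF assms] by (auto simp: card_2_iff)

section \<open>Full balls are binary trees\<close>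

lemma card_ball_less: "u \<in> V \<Longrightarrow> card (B m u) < 2 ^ Suc m"
proof (induction m arbitrary: u)
  case (Suc m)
  obtain a b where ab: "N u = {a, b}" "a \<noteq> b" "a \<in> V" "b \<in> V"
    using obtain_N[OF Suc.prems] .
  have "card (B (Suc m) u) = card (insert u (B m a \<union> B m b))"
    using ab by (simp add: out_ball_Suc)
  also have "\<dots> \<le> Suc (card (B m a \<union> B m b))"
    using finite_ball ab by (simp add: card_insert_if)
  also have "\<dots> \<le> Suc (card (B m a) + card (B m b))"
    by (simp add: card_Un_le)
  also have "\<dots> < 2 ^ Suc (Suc m)"
    using Suc.IH[OF ab(3)] Suc.IH[OF ab(4)] by simp
  finally show ?case .
qed simp

text \<open>Each ball of radius k - 1 has fewer than 2^k vertices, and the two of them with the root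
  must supply 2^(k+1) - 1, so nothing may be counted twice.\<close>

lemma ball_disjoint_k:
  assumes u: "u \<in> V" and N: "N u = {a, b}" "a \<noteq> b"
  shows "u \<notin> B (k - 1) a" "u \<notin> B (k - 1) b" "B (k - 1) a \<inter> B (k - 1) b = {}"
proof -
  define A where "A = B (k - 1) a"
  define C where "C = B (k - 1) b"
  have V: "a \<in> V" "b \<in> V" using N N_in_V[OF u] by auto
  have fin: "finite A" "finite C" using finite_ball V by (auto simp: A_def C_def)
  have small: "card A < 2 ^ k" "card C < 2 ^ k"
    using card_ball_less[OF V(1), of "k - 1"] card_ball_less[OF V(2), of "k - 1"] k_pos
    by (auto simp: A_def C_def)
  have "B k u = insert u (A \<union> C)"
    using k_pos N by (cases k) (auto simp: out_ball_Suc A_def C_def)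
  then have "card (insert u (A \<union> C)) = 2 ^ Suc k - 1"
    using card_ball_k[OF u] by simp
  moreover have "card (A \<union> C) + card (A \<inter> C) = card A + card C"
    by (rule card_Un_Int[OF fin, symmetric])
  moreover have "card (insert u (A \<union> C)) = (if u \<in> A \<union> C then card (A \<union> C) else Suc (card (A \<union> C)))"
    using fin by (simp add: card_insert_if)
  ultimately have "u \<notin> A \<union> C" "card (A \<inter> C) = 0"
    using small by (simp_all split: if_splits)
  then show "u \<notin> B (k - 1) a" "u \<notin> B (k - 1) b" "B (k - 1) a \<inter> B (k - 1) b = {}"
    using fin by (simp_all add: A_def C_def)
qed

text \<open>The root avoids the balls of its children by \<open>ball_disjoint_k\<close>; hence no
  closed walk has positive length at most k.\<close>

lemma girth:
  assumes "u \<in> V" "v \<in> N u" "m < k" shows "u \<notin> B m v"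
proof -
  obtain b where "N u = {v, b}" "v \<noteq> b"
    using card_2_obtain_other[OF card_N[OF assms(1)] assms(2)] .
  then have "u \<notin> B (k - 1) v" using ball_disjoint_k(1)[OF assms(1)] by blast
  moreover have "m \<le> k - 1" using assms(3) by simp
  ultimately show ?thesis using out_ball_mono[of m "k - 1" N v] by blast
qed

lemma ball_disjoint:
  assumes "u \<in> V" "v \<in> N u" "w \<in> N u" "v \<noteq> w" "m < k" "m' < k"
  shows "B m v \<inter> B m' w = {}"
proof -
  obtain b where b: "N u = {v, b}" "v \<noteq> b"
    using card_2_obtain_other[OF card_N[OF assms(1)] assms(2)] .
  then have "B (k - 1) v \<inter> B (k - 1) w = {}"
    using ball_disjoint_k(3)[OF assms(1) b] assms(3,4) by auto
  moreover have "B m v \<subseteq> B (k - 1) v" "B m' w \<subseteq> B (k - 1) w"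
    using assms(5,6) by (simp_all add: out_ball_mono)
  ultimately show ?thesis by blast
qed

text \<open>Disjointness splits a ball into its root and two separate balls, so sums over balls obey
  the recursion of a binary tree.\<close>

lemma sum_ball_Suc:
  fixes f :: "'a \<Rightarrow> 'b::comm_monoid_add"
  assumes u: "u \<in> V" and m: "m < k"
  shows "sum f (B (Suc m) u) = f u + (\<Sum>v\<in>N u. sum f (B m v))"
proof -
  have "sum f (\<Union>v\<in>N u. B m v) = (\<Sum>v\<in>N u. sum f (B m v))"
    using finite_N[OF u] finite_ball N_in_V[OF u] ball_disjoint[OF u _ _ _ m m]
    by (subst sum.UNION_disjoint) auto
  moreover have "u \<notin> (\<Union>v\<in>N u. B m v)" using girth[OF u _ m] by blast
  moreover have "finite (\<Union>v\<in>N u. B m v)" using finite_N[OF u] finite_ball N_in_V[OF u] by auto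
  ultimately show ?thesis by (simp add: out_ball_Suc)
qed

lemma card_ball: "u \<in> V \<Longrightarrow> m \<le> k \<Longrightarrow> card (B m u) = 2 ^ Suc m - 1"
proof (induction m arbitrary: u)
  case (Suc m)
  have "card (B (Suc m) u) = 1 + (\<Sum>v\<in>N u. card (B m v))"
    using sum_ball_Suc[of u m "\<lambda>_. 1::nat"] Suc.prems by simp
  also have "(\<Sum>v\<in>N u. card (B m v)) = (\<Sum>v\<in>N u. 2 ^ Suc m - 1)"
    using Suc N_in_V[OF Suc.prems(1)] by (intro sum.cong) auto
  also have "1 + \<dots> = 2 ^ Suc (Suc m) - 1"
    using card_N[OF Suc.prems(1)] by (cases "2 ^ m :: nat") simp_all
  finally show ?case .
qed simp

text \<open>Apply \<open>sum_ball_Suc\<close> to the indicator of v. With S_m = I + A + ... + A^m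
  this is the (u, v) entry of S_(m+1) = I + A S_m; \<open>in_ball_Suc_preds\<close> below is the
  form I + S_m A.\<close>

lemma in_ball_Suc:
  assumes "u \<in> V" "m < k"
  shows "(of_bool (v \<in> B (Suc m) u) :: int)
       = of_bool (v = u) + (\<Sum>w\<in>N u. of_bool (v \<in> B m w))"
proof -
  have *: "(\<Sum>x\<in>A. of_bool (x = v)) = (of_bool (v \<in> A) :: int)" if "finite A" for A
    using that by (simp add: sum.If_cases of_bool_def)
  have "(\<Sum>x\<in>B (Suc m) u. of_bool (x = v) :: int)
      = of_bool (u = v) + (\<Sum>w\<in>N u. \<Sum>x\<in>B m w. of_bool (x = v))"
    by (rule sum_ball_Suc[OF assms])
  also have "(\<Sum>w\<in>N u. \<Sum>x\<in>B m w. of_bool (x = v) :: int) = (\<Sum>w\<in>N u. of_bool (v \<in> B m w))"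
    using finite_ball N_in_V[OF assms(1)] by (intro sum.cong * ) auto
  finally show ?thesis
    using *[OF finite_ball[OF assms(1), of "Suc m"]] by (simp only: eq_commute[of v u])
qed

text \<open>Entrywise, A commutes with I + A + ... + A^m: membership in a ball counts walks.\<close>
lemma ball_exchange:
  assumes "u \<in> V" "v \<in> V" "m \<le> k"
  shows "(\<Sum>w\<in>N u. of_bool (v \<in> B m w) :: int) = (\<Sum>x\<in>preds v. of_bool (x \<in> B m u))"
  using assms
proof (induction m arbitrary: u)
  case 0
  have "(\<Sum>w\<in>N u. of_bool (v = w) :: int) = of_bool (v \<in> N u)"
    using finite_N[OF 0(1)] by (simp add: sum.If_cases of_bool_def)
  also have "\<dots> = (\<Sum>x\<in>preds v. of_bool (x = u))"
    using 0 by (simp add: of_bool_def preds_iff)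
  finally show ?case by simp
next
  case (Suc m)
  have m: "m < k" using Suc.prems by simp
  have "(\<Sum>w\<in>N u. of_bool (v \<in> B (Suc m) w) :: int)
      = (\<Sum>w\<in>N u. of_bool (v = w) + (\<Sum>x\<in>preds v. of_bool (x \<in> B m w)))"
    using Suc N_in_V[OF Suc.prems(1)] by (intro sum.cong refl) (simp only: in_ball_Suc[OF _ m] less_imp_le)
  also have "\<dots> = of_bool (v \<in> N u) + (\<Sum>x\<in>preds v. \<Sum>w\<in>N u. of_bool (x \<in> B m w))"
    using finite_N[OF Suc.prems(1)] sum.swap[of _ "preds v" "N u"]
    by (simp add: sum.distrib of_bool_def)
  also have "of_bool (v \<in> N u) = (\<Sum>x\<in>preds v. of_bool (x = u) :: int)"
    using Suc.prems by (simp add: of_bool_def preds_iff)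
  also have "\<dots> + (\<Sum>x\<in>preds v. \<Sum>w\<in>N u. of_bool (x \<in> B m w))
      = (\<Sum>x\<in>preds v. of_bool (x \<in> B (Suc m) u))"
    by (simp only: in_ball_Suc[OF Suc.prems(1) m] sum.distrib)
  finally show ?case .
qed

lemma in_ball_Suc_preds:
  assumes "u \<in> V" "v \<in> V" "m < k"
  shows "(of_bool (v \<in> B (Suc m) u) :: int)
       = of_bool (v = u) + (\<Sum>x\<in>preds v. of_bool (x \<in> B m u))"
  unfolding in_ball_Suc[OF assms(1,3)] ball_exchange[OF assms(1,2) less_imp_le[OF assms(3)]] ..

lemma sum_of_bool_card:
  "finite A \<Longrightarrow> (\<Sum>x\<in>A. of_bool (P x) :: int) = int (card {x \<in> A. P x})"
  by (simp add: Int_def)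

text \<open>By \<open>in_ball_Suc_preds\<close>, [z = u] plus the number of predecessors of z within
  k - 1 steps of u is at most 1.\<close>

lemma unique_parent:
  assumes u: "u \<in> V" and x: "x \<in> B m u" "m < k" "z \<in> N x" and y: "y \<in> B m' u" "m' < k" "z \<in> N y"
  shows "x = y" "z \<noteq> u"
proof -
  have V: "x \<in> V" "y \<in> V" "z \<in> V"
    using ball_subset_V[OF u] x y N_in_V by blast+
  have k1: "x \<in> B (k - 1) u" "y \<in> B (k - 1) u"
    using in_ball_pred x(1,2) y(1,2) by blast+
  let ?P = "{w \<in> preds z. w \<in> B (k - 1) u}"
  have *: "(of_bool (z \<in> B k u) :: int) = of_bool (z = u) + int (card ?P)"
    using in_ball_Suc_preds[OF u V(3), of "k - 1"] k_pos sum_of_bool_card[of "preds z" "\<lambda>w. w \<in> B (k - 1) u"] by simp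
  have xy: "{x, y} \<subseteq> ?P" using V x y k1 by (auto simp: preds_iff)
  have "card {x, y} \<le> card ?P" by (rule card_mono) (use xy in auto)
  moreover have "of_bool (z = u) + int (card ?P) \<le> 1" using * [symmetric] by (simp only:) simp
  ultimately have "of_bool (z = u) + int (card {x, y}) \<le> 1" by linarith
  then show "x = y" "z \<noteq> u" by (cases "x = y"; cases "z = u"; simp)+
qed

lemma has_parent:
  assumes "u \<in> V" "z \<in> B (Suc m) u" "z \<noteq> u" "m < k"
  obtains x where "x \<in> B m u" "z \<in> N x" "x \<in> V"
proof -
  have z: "z \<in> V" using assms ball_subset_V by blast
  have one: "(\<Sum>x\<in>preds z. of_bool (x \<in> B m u)) = (1::int)"
    using in_ball_Suc_preds[OF assms(1) z assms(4)] assms by simp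
  have "\<exists>x\<in>preds z. x \<in> B m u"
  proof (rule ccontr)
    assume "\<not> ?thesis"
    then have "(\<Sum>x\<in>preds z. of_bool (x \<in> B m u)) = (0::int)" by (intro sum.neutral) auto
    then show False using one by simp
  qed
  then show ?thesis using that by (auto simp: preds_iff)
qed

text \<open>If z appeared within m steps, it would be the root or have a parent closer to the root
  than y, against \<open>unique_parent\<close>. For m = k - 1 this is why no arc stays within a half
  of an outer level.\<close>

lemma level_step:
  assumes u: "u \<in> V" and m: "m < k" and y: "y \<in> B m u" "\<And>i. i < m \<Longrightarrow> y \<notin> B i u" and z: "z \<in> N y"
  shows "z \<notin> B m u"
proof
  assume zm: "z \<in> B m u"
  have "z \<noteq> u" using unique_parent(2)[OF u y(1) m z y(1) m z] .
  then obtain i where i: "m = Suc i" using zm by (cases m) auto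
  obtain x where "x \<in> B i u" "z \<in> N x" using has_parent[OF u zm[unfolded i] \<open>z \<noteq> u\<close>] m i by auto
  then have "x = y" using unique_parent(1)[OF u _ _ _ y(1) m z] m i by auto
  then show False using y(2)[of i] i \<open>x \<in> B i u\<close> by simp
qed

text \<open>Since A(J - O) = (J - O)A, the (u, v) entries of AO + JA and OA + AJ agree; the
  in-degree of v comes from JA and the 2 from AJ.\<close>

lemma outlier_exchange:
  assumes "u \<in> V" "v \<in> V"
  shows "card {w \<in> N u. v \<in> outliers w} + card (preds v) = card (preds v \<inter> outliers u) + 2"
proof -
  have 1: "{w \<in> N u. v \<in> outliers w} = N u - {w \<in> N u. v \<in> B k w}"
    using assms by (auto simp: outliers_iff)
  have 2: "preds v \<inter> outliers u = preds v - {x \<in> preds v. x \<in> B k u}"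
    by (auto simp: outliers_iff preds_iff)
  have 3: "card {w \<in> N u. v \<in> B k w} = card {x \<in> preds v. x \<in> B k u}"
    using ball_exchange[OF assms order_refl] finite_N[OF assms(1)]
    by (simp add: Collect_conj_eq)
  have "card {w \<in> N u. v \<in> B k w} \<le> card (N u)" "card {x \<in> preds v. x \<in> B k u} \<le> card (preds v)"
    using finite_N[OF assms(1)] by (auto intro!: card_mono)
  moreover have "card {w \<in> N u. v \<in> outliers w} = card (N u) - card {w \<in> N u. v \<in> B k w}"
    unfolding 1 using finite_N[OF assms(1)] by (intro card_Diff_subset) auto
  moreover have "card (preds v \<inter> outliers u) = card (preds v) - card {x \<in> preds v. x \<in> B k u}"
    unfolding 2 by (intro card_Diff_subset) auto
  ultimately show ?thesis using 3 card_N[OF assms(1)] by simp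
qed

section \<open>Defects and column sums of the outlier matrix\<close>

lemma sum_preds:
  fixes f :: "'a \<Rightarrow> int"
  shows "(\<Sum>u\<in>V. \<Sum>w\<in>N u. f w) = (\<Sum>w\<in>V. int (card (preds w)) * f w)"
proof -
  have "(\<Sum>u\<in>V. \<Sum>w\<in>N u. f w) = (\<Sum>u\<in>V. \<Sum>w\<in>V. of_bool (w \<in> N u) * f w)"
  proof (rule sum.cong[OF refl])
    fix u assume "u \<in> V"
    then have "{w \<in> V. w \<in> N u} = N u" using N_subset by auto
    then show "(\<Sum>w\<in>N u. f w) = (\<Sum>w\<in>V. of_bool (w \<in> N u) * f w)"
      using finite_V by (simp add: of_bool_def if_distrib[of "\<lambda>x. x * _"] sum.If_cases Int_def cong: if_cong)
  qed
  also have "\<dots> = (\<Sum>w\<in>V. (\<Sum>u\<in>V. of_bool (w \<in> N u)) * f w)"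
    by (subst sum.swap) (simp add: sum_distrib_right)
  finally show ?thesis
    using finite_V by (simp add: preds_def Collect_conj_eq)
qed

definition defect :: "'a \<Rightarrow> int" where
  "defect v = 2 - int (card (preds v))"

lemma sum_defect: "(\<Sum>v\<in>V. defect v) = 0"
proof -
  have "(\<Sum>w\<in>V. int (card (preds w))) = (\<Sum>u\<in>V. 2)"
    using sum_preds[of "\<lambda>_. 1"] card_N by simp
  then show ?thesis by (simp add: defect_def sum_subtractf)
qed

text \<open>
  \<open>weight k w v\<close> is \<open>2 ^ (k - d) - 1\<close> if v has distance \<open>d \<le> k\<close> from w, and 0 otherwise.
\<close>
primrec weight :: "nat \<Rightarrow> 'a \<Rightarrow> 'a \<Rightarrow> int" where
  "weight 0 w v = 0"
| "weight (Suc m) w v = 2 * weight m w v + of_bool (v \<in> B m w)"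

definition misses :: "'a \<Rightarrow> 'a set" where
  "misses v = {u \<in> V. v \<in> outliers u}"

text \<open>When \<open>in_ball_Suc\<close> is summed over u, each w occurs once per predecessor,
  that is 2 - \<open>defect w\<close> times. Iteration doubles the earlier defect terms at each
  step, which is the recursion of \<open>weight\<close>.\<close>

lemma in_ball_count:
  assumes v: "v \<in> V"
  shows "m \<le> k \<Longrightarrow> (\<Sum>u\<in>V. of_bool (v \<in> B m u) :: int)
    = 2 ^ Suc m - 1 - (\<Sum>w\<in>V. defect w * weight m w v)"
proof (induction m)
  case 0
  then show ?case using v finite_V by (simp add: of_bool_def)
next
  case (Suc m)
  have "(\<Sum>u\<in>V. of_bool (v \<in> B (Suc m) u) :: int)
      = (\<Sum>u\<in>V. of_bool (v = u) + (\<Sum>w\<in>N u. of_bool (v \<in> B m w)))"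
    using in_ball_Suc Suc.prems by (intro sum.cong refl) simp
  also have "\<dots> = 1 + (\<Sum>w\<in>V. int (card (preds w)) * of_bool (v \<in> B m w))"
    using v finite_V sum_preds[of "\<lambda>w. of_bool (v \<in> B m w)"]
    by (simp add: sum.distrib of_bool_def)
  also have "\<dots> = 1 + (\<Sum>w\<in>V. 2 * of_bool (v \<in> B m w) - defect w * of_bool (v \<in> B m w))"
    by (simp add: defect_def algebra_simps)
  also have "\<dots> = 1 + 2 * (\<Sum>w\<in>V. of_bool (v \<in> B m w)) - (\<Sum>w\<in>V. defect w * of_bool (v \<in> B m w))"
    by (simp add: sum_subtractf sum_distrib_left)
  also have "\<dots> = 2 ^ Suc (Suc m) - 1 - (2 * (\<Sum>w\<in>V. defect w * weight m w v)
      + (\<Sum>w\<in>V. defect w * of_bool (v \<in> B m w)))"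
    using Suc by (simp add: algebra_simps)
  also have "2 * (\<Sum>w\<in>V. defect w * weight m w v) + (\<Sum>w\<in>V. defect w * of_bool (v \<in> B m w))
      = (\<Sum>w\<in>V. defect w * weight (Suc m) w v)"
    by (simp add: sum_distrib_left sum.distrib[symmetric] algebra_simps)
  finally show ?case .
qed

text \<open>This is the column sum of O at v: the excess plus the weighted defects. As it cannot be
  negative, it bounds the negative defects by the positive ones.\<close>

lemma card_misses:
  assumes v: "v \<in> V"
  shows "int (card (misses v)) = int (card V) - (2 ^ Suc k - 1) + (\<Sum>w\<in>V. defect w * weight k w v)"
proof -
  have "misses v = V - {u \<in> V. v \<in> B k u}" using v by (auto simp: misses_def outliers_iff)
  then have "int (card (misses v)) = int (card V) - int (card {u \<in> V. v \<in> B k u})"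
    using finite_V by (simp add: card_Diff_subset card_mono of_nat_diff)
  then show ?thesis
    using in_ball_count[OF v order_refl] finite_V by (simp add: Collect_conj_eq)
qed

lemma weight_nonneg: "0 \<le> weight m w v"
  by (induction m) auto

lemma weight_eq_0: "(\<And>i. i < m \<Longrightarrow> v \<notin> B i w) \<Longrightarrow> weight m w v = 0"
  by (induction m) auto

text \<open>All terms before radius j vanish, and the remaining d steps contribute at most 1 + 2 +
  ... + 2^(d-1).\<close>

lemma weight_le:
  assumes "\<And>i. i < j \<Longrightarrow> v \<notin> B i w" shows "weight (j + d) w v \<le> 2 ^ d - 1"
  using weight_eq_0[OF assms] by (induction d) auto

lemma weight_eq:
  assumes "\<And>i. i < j \<Longrightarrow> v \<notin> B i w" "v \<in> B j w" shows "weight (j + d) w v = 2 ^ d - 1"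
proof (induction d)
  case (Suc d)
  have "v \<in> B (j + d) w" using assms(2) out_ball_mono[of j "j + d" N w] by auto
  then show ?case using Suc by simp
qed (use weight_eq_0[OF assms(1)] in simp)

lemma weight_self: "weight k v v = 2 ^ k - 1"
  using weight_eq[of 0 v v k] by simp

lemma weight_arc: assumes "w \<in> V" "v \<in> N w" shows "weight k w v = 2 ^ (k - 1) - 1"
proof -
  have "v \<noteq> w" using girth[OF assms k_pos] by auto
  then show ?thesis using weight_eq[of 1 v w "k - 1"] assms k_pos by (simp add: out_ball_Suc)
qed

lemma weight_le_1: assumes "v \<noteq> w" shows "weight k w v \<le> 2 ^ (k - 1) - 1"
  using weight_le[of 1 v w "k - 1"] assms k_pos by simp

lemma weight_le_2: assumes "v \<noteq> w" "v \<notin> N w" "2 \<le> k" shows "weight k w v \<le> 2 ^ (k - 2) - 1"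
proof -
  have "v \<notin> B i w" if "i < 2" for i using assms that by (auto simp: less_2_cases_iff out_ball_Suc)
  then have "weight (2 + (k - 2)) w v \<le> 2 ^ (k - 2) - 1" by (rule weight_le)
  then show ?thesis by (simp only: le_add_diff_inverse[OF assms(3)])
qed

lemma weight_le_3: assumes "v \<notin> B 2 w" "3 \<le> k" shows "weight k w v \<le> 2 ^ (k - 3) - 1"
proof -
  have "v \<notin> B i w" if "i < 3" for i using assms out_ball_mono[of i 2 N w] that by auto
  then have "weight (3 + (k - 3)) w v \<le> 2 ^ (k - 3) - 1" by (rule weight_le)
  then show ?thesis using assms(2) by simp
qed

lemma weight_far: assumes "v \<notin> B (k - 1) w" shows "weight k w v = 0"
proof (rule weight_eq_0)
  fix i assume "i < k"
  then show "v \<notin> B i w" using assms in_ball_pred by blast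
qed

text \<open>A walk of length at most k from u to v starts with a child of u. This is also a child of
  v, so the rest of the walk would close up to a cycle of length at most k.\<close>

lemma clone_outlier:
  assumes "u \<in> V" "v \<in> V" "u \<noteq> v" "N u = N v"
  shows "v \<in> outliers u"
proof -
  have "v \<notin> B (k - 1) w" if "w \<in> N u" for w
    using girth[of v w "k - 1"] assms that k_pos by simp
  moreover have "B k u = insert u (\<Union>w\<in>N u. B (k - 1) w)" using k_pos by (cases k) (auto simp: out_ball_Suc)
  ultimately show ?thesis using assms by (auto simp: outliers_iff)
qed

lemma not_outlier_self: "u \<notin> outliers u"
  by (simp add: outliers_iff)

lemma ball_k_iff: "x \<in> B k u \<longleftrightarrow> x = u \<or> (\<exists>w\<in>N u. x \<in> B (k - 1) w)"
  using k_pos by (cases k) (auto simp: out_ball_Suc)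

lemma card_outliers: assumes "u \<in> V" shows "card (outliers u) + 2 ^ Suc k = card V + 1"
proof -
  have "card (outliers u) = card V - card (B k u)"
    unfolding outliers_def by (rule card_Diff_subset[OF finite_ball ball_subset_V]) fact+
  moreover have "card (B k u) \<le> card V" by (rule card_mono[OF finite_V ball_subset_V]) fact
  moreover have "(1::nat) \<le> 2 ^ Suc k" by simp
  ultimately show ?thesis using card_ball_k[OF assms] by simp
qed

end

section \<open>Alternating signs on the boundary of a ball\<close>

text \<open>The first m terms of 1 - 2 + 4 - ..., the level sizes of a binary tree with alternating
  signs.\<close>

primrec alt_sum :: "nat \<Rightarrow> int" where
  "alt_sum 0 = 0"
| "alt_sum (Suc m) = 1 - 2 * alt_sum m"

lemma alt_sum_closed: "3 * alt_sum m = 1 - (- 2) ^ m"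
  by (induction m) auto

lemma abs_minus_two_power: "\<bar>(- 2) ^ m\<bar> = (2 ^ m :: int)"
  by (simp add: power_abs)

lemma alt_sum_neq_unit:
  assumes "3 \<le> m" shows "\<bar>alt_sum m\<bar> \<noteq> 1"
proof
  assume "\<bar>alt_sum m\<bar> = 1"
  then have "\<bar>(- 2) ^ m\<bar> \<le> (4::int)" using alt_sum_closed[of m] by linarith
  then have "(2::int) ^ m \<le> 4" by (simp add: abs_minus_two_power)
  moreover have "(2::int) ^ 3 \<le> 2 ^ m" using assms by (intro power_increasing) auto
  ultimately show False by simp
qed

text \<open>The absolute values are 0, 1, 1, 3, 5, 11, ... and increase strictly past index 2, so
  only the indices 1 and 2 can collide.\<close>

lemma alt_sum_abs_eq:
  assumes "\<bar>alt_sum n\<bar> = \<bar>alt_sum m\<bar>" "0 < m" "m < n"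
  shows "n = 2"
proof -
  have "3 * \<bar>alt_sum n\<bar> = \<bar>1 - (- 2) ^ n\<bar>" "3 * \<bar>alt_sum m\<bar> = \<bar>1 - (- 2) ^ m\<bar>"
    using alt_sum_closed[of n] alt_sum_closed[of m] by linarith+
  then have "\<bar>(- 2) ^ n\<bar> \<le> \<bar>(- 2) ^ m\<bar> + (2::int)" using assms(1) by linarith
  then have le: "(2::int) ^ n \<le> 2 ^ m + 2" by (simp add: abs_minus_two_power)
  obtain d where d: "n = Suc (m + d)" using assms(3) less_iff_Suc_add by auto
  have "(2::int) ^ m \<le> 2 ^ (m + d)" by simp
  then have "(2::int) ^ m \<le> 2" using le unfolding d power_Suc by linarith
  then have "(2::int) ^ m \<le> 2 ^ 1" by (simp only: power_one_right)
  then have "m \<le> 1" by (simp only: power_increasing_iff)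
  then have "m = 1" using assms(2) by simp
  then have "(2::int) ^ n \<le> 2 ^ 2" using le by simp
  then have "n \<le> 2" by (simp only: power_increasing_iff)
  then show ?thesis using assms(3) \<open>m = 1\<close> by simp
qed

context binary_geodetic
begin

text \<open>Each further level flips the sign and doubles the number of vertices, so level i
  contributes f y * (-2)^i.\<close>

lemma alternating_sum:
  fixes f :: "'a \<Rightarrow> int"
  assumes "y \<in> V" "m \<le> k"
    and "\<And>x z. x \<in> B m y \<Longrightarrow> z \<in> N x \<Longrightarrow> z \<in> B m y \<Longrightarrow> f z = - f x"
  shows "sum f (B m y) = f y * alt_sum (Suc m)"
  using assms
proof (induction m arbitrary: y)
  case (Suc m)
  have "sum f (B (Suc m) y) = f y + (\<Sum>v\<in>N y. sum f (B m v))"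
    using sum_ball_Suc[of y m f] Suc.prems by simp
  also have "(\<Sum>v\<in>N y. sum f (B m v)) = (\<Sum>v\<in>N y. - f y * alt_sum (Suc m))"
  proof (rule sum.cong[OF refl])
    fix v assume v: "v \<in> N y"
    have sub: "B m v \<subseteq> B (Suc m) y" using v by (auto simp: out_ball_Suc)
    have "sum f (B m v) = f v * alt_sum (Suc m)"
      using Suc.IH[of v] Suc.prems N_in_V[OF _ v] sub by (meson Suc_leD subsetD)
    moreover have "f v = - f y" using Suc.prems(3)[OF out_ball_self v subsetD[OF sub out_ball_self]] .
    ultimately show "sum f (B m v) = - f y * alt_sum (Suc m)" by simp
  qed
  finally show ?case
    using card_N[OF Suc.prems(1)] by (simp add: algebra_simps)
qed simp

text \<open>For k >= 2 these are the vertices at distance exactly k - 1 from c. For the two children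
  of b they are the halves R1 and R2 of the level at distance k from b.\<close>

definition rim :: "'a \<Rightarrow> 'a set" where
  "rim c = B (k - 1) c - B (k - 2) c"

definition sign :: "'a \<Rightarrow> 'a \<Rightarrow> 'a \<Rightarrow> int" where
  "sign c c' z = of_bool (z \<in> rim c) - of_bool (z \<in> rim c')"

lemma card_rim: "c \<in> V \<Longrightarrow> 2 \<le> k \<Longrightarrow> card (rim c) = 2 ^ (k - 1)"
proof -
  assume c: "c \<in> V" and k: "2 \<le> k"
  then obtain j where j: "k = Suc (Suc j)" by (metis add_2_eq_Suc le_Suc_ex)
  have "card (rim c) = card (B (k - 1) c) - card (B (k - 2) c)"
    unfolding rim_def using finite_ball[OF c] by (intro card_Diff_subset out_ball_mono) auto
  then show ?thesis using card_ball[OF c, of "k - 1"] card_ball[OF c, of "k - 2"] j by simp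
qed

lemma rim_step:
  assumes "c \<in> V" "x \<in> rim c" "z \<in> N x" shows "z \<notin> B (k - 1) c"
proof (rule level_step[OF assms(1) _ _ _ assms(3)])
  fix i assume "i < k - 1"
  then have "i \<le> k - 2" by simp
  then show "x \<notin> B i c" using assms(2) in_ball_mono[of x N i c "k - 2"] by (auto simp: rim_def)
qed (use assms(2) k_pos in \<open>auto simp: rim_def\<close>)

section \<open>The two halves of an outer level\<close>

context
  fixes b c c'
  assumes b: "b \<in> V" and children: "N b = {c, c'}" "c \<noteq> c'" and k2: "2 \<le> k"
begin

lemma children_V: "c \<in> V" "c' \<in> V"
  using N_subset[OF b] children by auto

lemma rims_disjoint: "rim c \<inter> rim c' = {}"
  using ball_disjoint_k(3)[OF b children] by (auto simp: rim_def)

lemma outer_level: "B k b - B (k - 1) b = rim c \<union> rim c'"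
proof -
  have 1: "B k b = insert b (B (k - 1) c \<union> B (k - 1) c')"
    using k_pos children by (cases k) (auto simp: out_ball_Suc)
  have "k - 1 = Suc (k - 2)" using k2 by simp
  then have 2: "B (k - 1) b = insert b (B (k - 2) c \<union> B (k - 2) c')"
    using children by (auto simp: out_ball_Suc)
  have 3: "B (k - 1) c \<inter> B (k - 2) c' = {}" "B (k - 2) c \<inter> B (k - 1) c' = {}"
    using ball_disjoint[OF b, of c c' "k - 1" "k - 2"] ball_disjoint[OF b, of c c' "k - 2" "k - 1"] children k2
    by simp_all
  show ?thesis
    unfolding 1 2 using 3 ball_disjoint_k(1,2)[OF b children] by (auto simp: rim_def)
qed

lemma sum_sign: "sum (sign c c') (rim c \<union> rim c') = 0"
proof -
  have fin: "finite (rim c)" "finite (rim c')"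
    using finite_ball children_V by (auto simp: rim_def)
  have "sum (sign c c') (rim c \<union> rim c') = sum (sign c c') (rim c) + sum (sign c c') (rim c')"
    using rims_disjoint fin by (intro sum.union_disjoint) auto
  also have "sum (sign c c') (rim c) = (\<Sum>z\<in>rim c. 1)"
    using rims_disjoint by (intro sum.cong) (auto simp: sign_def)
  also have "sum (sign c c') (rim c') = (\<Sum>z\<in>rim c'. - 1)"
    using rims_disjoint by (intro sum.cong) (auto simp: sign_def)
  finally show ?thesis using card_rim children_V k2 by simp
qed

lemma sign_cases: "z \<in> rim c \<union> rim c' \<Longrightarrow> sign c c' z = 1 \<or> sign c c' z = - 1"
  using rims_disjoint by (auto simp: sign_def)

text \<open>By \<open>rim_step\<close> no arc leads from a half into itself.\<close>

lemma sign_arc: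
  assumes "x \<in> rim c \<union> rim c'" "z \<in> rim c \<union> rim c'" "z \<in> N x"
  shows "sign c c' z = - sign c c' x"
  using assms rim_step[OF children_V(1), of x z] rim_step[OF children_V(2), of x z] rims_disjoint
  by (auto simp: sign_def rim_def)

text \<open>Two parents of z in one half would both lie within k - 1 steps of the same child of b,
  against \<open>unique_parent\<close>.\<close>

lemma sign_coparents:
  assumes "x \<in> rim c \<union> rim c'" "y \<in> rim c \<union> rim c'" "x \<noteq> y" "z \<in> N x" "z \<in> N y"
  shows "sign c c' x = - sign c c' y"
proof -
  have "\<not> (x \<in> rim d \<and> y \<in> rim d)" if "d \<in> V" for d
    using unique_parent(1)[OF that, of x "k - 1" z y "k - 1"] assms k_pos by (auto simp: rim_def)
  then show ?thesis using assms children_V rims_disjoint by (auto simp: sign_def)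
qed

end

lemma card_outer_level:
  assumes "b \<in> V" shows "card (B k b - B (k - 1) b) = 2 ^ k"
proof -
  have "card (B k b - B (k - 1) b) = card (B k b) - card (B (k - 1) b)"
    using finite_ball[OF assms] by (intro card_Diff_subset out_ball_mono) auto
  then show ?thesis
    using card_ball[OF assms, of k] card_ball[OF assms, of "k - 1"] k_pos by simp
qed

lemma sibling_outlier:
  assumes k: "3 \<le> k" and u: "u \<in> V" and N: "N u = {a, b}" "a \<noteq> b"
  obtains e where "e \<in> outliers b" "e \<in> B (k - 1) a"
proof -
  have ab: "a \<in> V" "b \<in> V" using N_subset[OF u] N by auto
  have "\<not> B (k - 1) a \<subseteq> B k b"
  proof
    assume "B (k - 1) a \<subseteq> B k b"
    moreover have "B (k - 1) a \<inter> B (k - 1) b = {}" using ball_disjoint_k(3)[OF u N] .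
    ultimately have sub: "B (k - 1) a \<subseteq> B k b - B (k - 1) b" by auto
    obtain c c' where c: "N b = {c, c'}" "c \<noteq> c'" using obtain_N[OF ab(2)] .
    note level = outer_level[OF ab(2) c]
    have k2: "2 \<le> k" using k by simp
    let ?D = "B k b - B (k - 1) b"
    have fin: "finite ?D" using finite_ball ab by auto
    \<comment> \<open>The level has 2^k vertices and the ball of a has 2^k - 1, so one vertex w is
      left over. The signs on the level cancel, so the alternating sum over the ball is minus the
      sign of w, a unit.\<close>
    have "card (?D - B (k - 1) a) = card ?D - card (B (k - 1) a)"
      using sub finite_ball[OF ab(1)] by (intro card_Diff_subset) auto
    also have "\<dots> = 1"
      using card_outer_level[OF ab(2)] card_ball[OF ab(1), of "k - 1"] k one_le_power[of "2::nat" k] by simp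
    finally obtain w where w: "?D - B (k - 1) a = {w}" by (auto simp: card_1_singleton_iff)
    let ?f = "sign c c'"
    have "0 = sum ?f ?D" using sum_sign[OF ab(2) c k2] level[OF k2] by simp
    also have "\<dots> = sum ?f (?D - B (k - 1) a) + sum ?f (B (k - 1) a)"
      by (rule sum.subset_diff[OF sub fin])
    also have "sum ?f (B (k - 1) a) = ?f a * alt_sum (Suc (k - 1))"
      using sub unfolding level[OF k2]
      by (intro alternating_sum[OF ab(1)] sign_arc[OF ab(2) c k2]) auto
    finally have "?f w + ?f a * alt_sum k = 0" using w k by simp
    moreover have "w \<in> ?D" "a \<in> ?D" using w subsetD[OF sub out_ball_self] by blast+
    then have "\<bar>?f w\<bar> = 1" "\<bar>?f a\<bar> = 1"
      using sign_cases[OF ab(2) c k2] unfolding level[OF k2] by fastforce+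
    ultimately have "\<bar>alt_sum k\<bar> = 1" by (metis abs_minus_cancel abs_mult add_eq_0_iff mult_1)
    then show False using alt_sum_neq_unit[OF k] by simp
  qed
  then show ?thesis using that ball_subset_V[OF ab(1)] by (auto simp: outliers_iff)
qed

end

section \<open>Excess one\<close>

declare alt_sum.simps(2) [simp del]

context binary_geodetic
begin

text \<open>
  The alternation may fail below one vertex e if the two subtrees of e carry opposite signs: they
  cancel, and the sum is off by \<open>\<plusminus> 2 * alt_sum m\<close>.
\<close>
lemma alternating_sum_with_break:
  fixes f :: "'a \<Rightarrow> int"
  assumes e: "e \<in> V" "N e = {d, d'}" "d \<noteq> d'" "f d + f d' = 0" "\<bar>f e\<bar> = 1"
    and arcs: "\<And>x z. x \<in> A \<Longrightarrow> z \<in> A \<Longrightarrow> x \<noteq> e \<Longrightarrow> z \<in> N x \<Longrightarrow> f z = - f x"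
    and "y \<in> V" "Suc i \<le> k" "B (Suc i) y \<subseteq> A" "e \<in> B i y"
  shows "\<exists>m s. 0 < m \<and> m \<le> Suc i \<and> (y \<noteq> e \<longrightarrow> m \<le> i) \<and> \<bar>s\<bar> = 1 \<and>
    sum f (B (Suc i) y) = f y * alt_sum (Suc (Suc i)) + 2 * s * alt_sum m"
  using assms(7-)
proof (induction i arbitrary: y)
  case 0
  then have y: "y = e" by simp
  have "sum f (B (Suc 0) y) = f y"
    using sum_ball_Suc[OF e(1), of 0 f] k_pos e y by simp
  then show ?case
    using y e(5) by (intro exI[of _ 1] exI[of _ "f e"]) (simp add: alt_sum.simps(2))
next
  case (Suc i)
  have straight: "sum f (B (Suc i) w) = f w * alt_sum (Suc (Suc i))"
    if "w \<in> V" "B (Suc i) w \<subseteq> A" "e \<notin> B (Suc i) w" for w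
    using that Suc.prems(2) by (intro alternating_sum arcs) auto
  show ?case
  proof (cases "y = e")
    case True
    have sub: "B (Suc i) w \<subseteq> A" if "w \<in> N e" for w
      using Suc.prems(3) that True unfolding out_ball_Suc[of N "Suc i"] by blast
    have "e \<notin> B (Suc i) d" "e \<notin> B (Suc i) d'"
      using girth[OF e(1), of _ "Suc i"] e(2) Suc.prems(2) by auto
    moreover have "d \<in> V" "d' \<in> V" using N_subset[OF e(1)] e(2) by auto
    ultimately have *: "sum f (B (Suc i) d) = f d * alt_sum (Suc (Suc i))"
        "sum f (B (Suc i) d') = f d' * alt_sum (Suc (Suc i))"
      using sub e(2) by (simp_all add: straight)
    have "sum f (B (Suc (Suc i)) y) = f y + (sum f (B (Suc i) d) + sum f (B (Suc i) d'))"
      using sum_ball_Suc[OF e(1), of "Suc i" f] Suc.prems(2) e(2,3) True by simp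
    also have "\<dots> = f y + (f d + f d') * alt_sum (Suc (Suc i))"
      unfolding * by (simp only: distrib_right)
    also have "\<dots> = f y" using e(4) by simp
    \<comment> \<open>Undisturbed alternation would give f y * (1 - 2 *
      \<open>alt_sum (Suc (Suc i))\<close>); the difference to the actual value f y dictates the
      witnesses.\<close>
    finally show ?thesis
      using e(5) True by (intro exI[of _ "Suc (Suc i)"] exI[of _ "f e"]) (simp add: alt_sum.simps(2)[of "Suc (Suc i)"] algebra_simps)
  next
    case False
    then obtain v where v: "v \<in> N y" "e \<in> B i v"
      using Suc.prems(4) by (auto simp: out_ball_Suc)
    obtain w where w: "N y = {v, w}" "v \<noteq> w"
      using card_2_obtain_other[OF card_N[OF Suc.prems(1)] v(1)] .
    have V: "v \<in> V" "w \<in> V" using N_subset[OF Suc.prems(1)] w by auto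
    have sub: "B (Suc i) x \<subseteq> A" if "x \<in> N y" for x
      using Suc.prems(3) that unfolding out_ball_Suc[of N "Suc i"] by blast
    have "B i v \<inter> B (Suc i) w = {}"
      using ball_disjoint[OF Suc.prems(1), of v w i "Suc i"] w Suc.prems(2) by simp
    then have "sum f (B (Suc i) w) = f w * alt_sum (Suc (Suc i))"
      using V sub w v(2) by (intro straight) auto
    moreover obtain m s where ms: "0 < m" "m \<le> Suc i" "\<bar>s\<bar> = 1"
        "sum f (B (Suc i) v) = f v * alt_sum (Suc (Suc i)) + 2 * s * alt_sum m"
      using Suc.IH[OF V(1) _ sub[OF v(1)] v(2)] Suc.prems(2) by auto
    moreover have "f x = - f y" if "x \<in> N y" for x
    proof (rule arcs[OF _ _ False that])
      show "y \<in> A" using subsetD[OF Suc.prems(3) out_ball_self] .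
      show "x \<in> A" using subsetD[OF sub[OF that] out_ball_self] .
    qed
    then have "f v = - f y" "f w = - f y" using w by auto
    moreover have "sum f (B (Suc (Suc i)) y) = f y + (sum f (B (Suc i) v) + sum f (B (Suc i) w))"
      using sum_ball_Suc[OF Suc.prems(1), of "Suc i" f] Suc.prems(2) w by simp
    ultimately show ?thesis
      by (intro exI[of _ m] exI[of _ s]) (simp add: alt_sum.simps(2)[of "Suc (Suc i)"] algebra_simps)
  qed
qed

section \<open>Vertices of in-degree below 2 (poor) and above 2 (rich)\<close>

definition poor :: "'a set" where
  "poor = {w \<in> V. 0 < defect w}"

definition rich :: "'a set" where
  "rich = {w \<in> V. defect w < 0}"

lemma finite_poor [simp]: "finite poor"
  unfolding poor_def using finite_V by (rule rev_finite_subset) blast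

lemma finite_rich [simp]: "finite rich"
  unfolding rich_def using finite_V by (rule rev_finite_subset) blast

lemma sum_defect_split:
  fixes g :: "'a \<Rightarrow> int"
  shows "(\<Sum>w\<in>V. defect w * g w) = (\<Sum>w\<in>poor. defect w * g w) + (\<Sum>w\<in>rich. defect w * g w)"
proof -
  have "(\<Sum>w\<in>V. defect w * g w) = (\<Sum>w\<in>poor \<union> rich. defect w * g w)"
    using finite_V by (intro sum.mono_neutral_right) (auto simp: poor_def rich_def)
  also have "\<dots> = (\<Sum>w\<in>poor. defect w * g w) + (\<Sum>w\<in>rich. defect w * g w)"
    by (intro sum.union_disjoint finite_poor finite_rich) (auto simp: poor_def rich_def)
  finally show ?thesis .
qed

lemma sum_poor_rich: "(\<Sum>w\<in>poor. defect w) = - (\<Sum>w\<in>rich. defect w)"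
  using sum_defect sum_defect_split[of "\<lambda>_. 1"] by simp

text \<open>Rich vertices enter with negative defect and nonnegative weight, so leaving some of them
  out of the count only increases it.\<close>

lemma misses_le:
  assumes v: "v \<in> V" and A: "A \<subseteq> rich"
  shows "int (card (misses v)) \<le> int (card V) - (2 ^ Suc k - 1)
    + (\<Sum>w\<in>poor. defect w * weight k w v) + (\<Sum>w\<in>A. defect w * weight k w v)"
proof -
  have "(\<Sum>w\<in>rich. defect w * weight k w v) = (\<Sum>w\<in>rich - A. defect w * weight k w v) + (\<Sum>w\<in>A. defect w * weight k w v)"
    by (rule sum.subset_diff[OF A finite_rich])
  moreover have "(\<Sum>w\<in>rich - A. defect w * weight k w v) \<le> 0"
    by (intro sum_nonpos mult_nonpos_nonneg weight_nonneg) (auto simp: rich_def)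
  ultimately show ?thesis using card_misses[OF v] sum_defect_split[of "\<lambda>w. weight k w v"] by linarith
qed

lemma outlier_double_count:
  assumes "u \<in> V" "finite A"
  shows "(\<Sum>w\<in>A. int (card {x \<in> N u. w \<in> outliers x})) = (\<Sum>x\<in>N u. int (card (outliers x \<inter> A)))"
proof -
  have "(\<Sum>w\<in>A. int (card {x \<in> N u. w \<in> outliers x})) = (\<Sum>w\<in>A. \<Sum>x\<in>N u. of_bool (w \<in> outliers x))"
    using finite_N[OF assms(1)] by (simp add: Collect_conj_eq)
  also have "\<dots> = (\<Sum>x\<in>N u. \<Sum>w\<in>A. of_bool (w \<in> outliers x))"
    by (rule sum.swap)
  also have "\<dots> = (\<Sum>x\<in>N u. int (card (outliers x \<inter> A)))"
    using assms(2) by (simp add: Int_commute)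
  finally show ?thesis .
qed

text \<open>Drop the number of predecessors of w among the outliers of u from
  \<open>outlier_exchange\<close>. So a poor vertex is missed by a child of every vertex.\<close>

lemma defect_le: "u \<in> V \<Longrightarrow> w \<in> V \<Longrightarrow> defect w \<le> int (card {x \<in> N u. w \<in> outliers x})"
  using outlier_exchange[of u w] by (simp add: defect_def)

lemma sum_defect_le:
  assumes "u \<in> V" "A \<subseteq> V"
  shows "(\<Sum>w\<in>A. defect w) \<le> (\<Sum>x\<in>N u. int (card (outliers x \<inter> A)))"
proof -
  have "finite A" using assms(2) finite_V by (rule finite_subset)
  then show ?thesis
    using sum_mono[of A defect "\<lambda>w. int (card {x \<in> N u. w \<in> outliers x})"]
      outlier_double_count[OF assms(1)] defect_le[OF assms(1)] assms(2) by (simp add: subset_iff)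
qed

lemma rich_nonempty:
  assumes "v \<in> V" "defect v \<noteq> 0"
  shows "rich \<noteq> {}"
proof
  assume "rich = {}"
  then have "\<forall>w\<in>V. 0 \<le> defect w" by (auto simp: rich_def not_less)
  then have "\<forall>w\<in>V. defect w = 0" using sum_defect sum_nonneg_eq_0_iff[OF finite_V, of defect] by simp
  then show False using assms by simp
qed

text \<open>Each of the two children of a vertex has one outlier, so the positive defects sum to at
  most 2. Nonnegativity of \<open>card (misses r)\<close> then forces every rich r to have defect -1
  and to be a child of every poor vertex, so all poor vertices share their two children a, b. The
  outliers of a and b must be poor, but \<open>sibling_outlier\<close> finds the outlier of b within
  k - 1 steps of a, its own child: a cycle that is too short.\<close>

lemma excess_one_regular:
  assumes k3: "3 \<le> k" and V: "card V = 2 ^ Suc k" and v: "v \<in> V"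
  shows "defect v = 0"
proof (rule ccontr)
  assume "defect v \<noteq> 0"
  then obtain r0 where r0: "r0 \<in> rich" using rich_nonempty[OF v] by auto
  have out1: "card (outliers u) = 1" if "u \<in> V" for u
    using card_outliers[OF that] V by simp
  \<comment> \<open>The weight at r is 2q - 1 from r itself and at most q - 1 from any other vertex,
    strictly less if there is no arc to r.\<close>
  define q where "q = (2::int) ^ (k - 1)"
  have q: "2 ^ k = 2 * q" "2 * 2 ^ (k - 2) = q" "4 \<le> q"
  proof -
    obtain j where "k = Suc (Suc (Suc j))"
      using k3 by (metis Suc_le_D numeral_3_eq_3 Suc_le_mono)
    then show "2 ^ k = 2 * q" "2 * 2 ^ (k - 2) = q" "4 \<le> q" by (simp_all add: q_def)
  qed
  have poor_le: "(\<Sum>w\<in>poor. defect w) \<le> 2"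
  proof -
    have r0V: "r0 \<in> V" using r0 by (simp add: rich_def)
    have "(\<Sum>w\<in>poor. defect w) \<le> (\<Sum>x\<in>N r0. int (card (outliers x \<inter> poor)))"
      by (rule sum_defect_le[OF r0V]) (auto simp: poor_def)
    also have "\<dots> \<le> (\<Sum>x\<in>N r0. 1)"
    proof (rule sum_mono)
      fix x assume "x \<in> N r0"
      then have "card (outliers x) = 1" using out1 N_in_V[OF r0V] by blast
      then show "int (card (outliers x \<inter> poor)) \<le> 1"
        using card_mono[of "outliers x" "outliers x \<inter> poor"] by simp
    qed
    finally show ?thesis using card_N[OF r0V] by simp
  qed
  have rich: "defect r = - 1 \<and> (\<Sum>w\<in>poor. defect w) = 2 \<and> (\<forall>w\<in>poor. r \<in> N w)" if r: "r \<in> rich" for r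
  proof -
    have rV: "r \<in> V" and neg: "defect r \<le> - 1" using r by (auto simp: rich_def)
    have "0 \<le> 1 + (\<Sum>w\<in>poor. defect w * weight k w r) + defect r * weight k r r"
      using misses_le[OF rV, of "{r}"] r V by simp
    define X where "X = defect r * (2 * q - 1)"
    define S where "S = (\<Sum>w\<in>poor. defect w * weight k w r)"
    have ge: "0 \<le> 1 + S + X"
      using \<open>0 \<le> _\<close> unfolding weight_self q(1) X_def S_def .
    have bound: "defect w * weight k w r \<le> defect w * (q - 1)" if "w \<in> poor" for w
    proof -
      have "r \<noteq> w" using that r by (auto simp: poor_def rich_def)
      then show ?thesis
        using that weight_le_1[of r w] by (intro mult_left_mono) (simp_all add: poor_def q_def)
    qed
    have total: "(\<Sum>w\<in>poor. defect w * (q - 1)) = (\<Sum>w\<in>poor. defect w) * (q - 1)"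
      by (simp add: sum_distrib_right)
    have le: "S \<le> (\<Sum>w\<in>poor. defect w) * (q - 1)"
      unfolding S_def
      using sum_mono[of poor "\<lambda>w. defect w * weight k w r" "\<lambda>w. defect w * (q - 1)", OF bound] total
      by simp
    have t2: "(\<Sum>w\<in>poor. defect w) * (q - 1) \<le> 2 * (q - 1)"
      using poor_le q(3) by (intro mult_right_mono) auto
    have le2: "S \<le> 2 * (q - 1)" using le t2 by (rule order_trans)
    have r1: "defect r = - 1"
    proof (rule ccontr)
      assume "defect r \<noteq> - 1"
      then have "X \<le> (- 2) * (2 * q - 1)"
        unfolding X_def using neg q(3) by (intro mult_right_mono) auto
      then have "X \<le> 2 - 4 * q" by simp
      moreover have "S \<le> 2 * q - 2" using le2 by simp
      ultimately show False using ge q(3) by linarith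
    qed
    then have X: "X = 1 - 2 * q" by (simp add: X_def)
    have "(\<Sum>w\<in>poor. defect w) = 2"
    proof (rule ccontr)
      assume "(\<Sum>w\<in>poor. defect w) \<noteq> 2"
      then have "(\<Sum>w\<in>poor. defect w) * (q - 1) \<le> 1 * (q - 1)"
        using poor_le q(3) by (intro mult_right_mono) auto
      then have "S \<le> 1 * (q - 1)" using le by (rule order_trans[rotated])
      then have "S \<le> q - 1" by simp
      then show False using ge X q(3) by linarith
    qed
    moreover have "r \<in> N w" if w: "w \<in> poor" for w
    proof (rule ccontr)
      assume "r \<notin> N w"
      then have "weight k w r \<le> 2 ^ (k - 2) - 1"
        using w r k3 by (intro weight_le_2) (auto simp: poor_def rich_def)
      then have "weight k w r < q - 1" using q(2,3) by linarith
      then have "defect w * weight k w r < defect w * (q - 1)"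
        using w by (intro mult_strict_left_mono) (auto simp: poor_def)
      then have "S < (\<Sum>w\<in>poor. defect w * (q - 1))"
        unfolding S_def using bound w by (intro sum_strict_mono_ex1) auto
      then have "S < 2 * (q - 1)" unfolding total using t2 by (rule less_le_trans)
      then have "S < 2 * q - 2" by simp
      then show False using ge X by linarith
    qed
    ultimately show ?thesis using r1 by blast
  qed
  have t: "(\<Sum>w\<in>poor. defect w) = 2" using rich[OF r0] by simp
  then have "(\<Sum>w\<in>rich. defect w) = - 2" using sum_poor_rich by simp
  moreover have "(\<Sum>w\<in>rich. defect w) = (\<Sum>w\<in>rich. - 1)" using rich by (intro sum.cong) auto
  ultimately have rich2: "card rich = 2" by simp
  obtain p where p: "p \<in> poor" using t by fastforce
  have pV: "p \<in> V" using p by (simp add: poor_def)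
  have N_poor: "N w = rich" if "w \<in> poor" for w
    using rich that rich2 card_N[of w] finite_N[of w]
    by (intro card_subset_eq[symmetric]) (auto simp: poor_def)
  obtain a b where ab: "N p = {a, b}" "a \<noteq> b" "a \<in> V" "b \<in> V" using obtain_N[OF pV] .
  have "2 \<le> int (card (outliers a \<inter> poor)) + int (card (outliers b \<inter> poor))"
    using sum_defect_le[OF pV, of poor] t ab by (simp add: poor_def)
  moreover have "card (outliers a \<inter> poor) \<le> 1"
    using card_mono[of "outliers a" "outliers a \<inter> poor"] out1[OF ab(3)] by simp
  ultimately have "card (outliers b) \<le> card (outliers b \<inter> poor)" using out1[OF ab(4)] by simp
  then have sub: "outliers b \<subseteq> poor"
    using card_seteq[of "outliers b" "outliers b \<inter> poor"] by auto
  obtain e where e: "e \<in> outliers b" "e \<in> B (k - 1) a" using sibling_outlier[OF k3 pV ab(1,2)] .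
  have "e \<in> poor" using sub e(1) by blast
  then have "N e = {a, b}" "e \<in> V" using N_poor[OF p] N_poor[of e] ab(1) by (simp_all add: poor_def)
  then have "a \<in> N e" by simp
  note \<open>e \<in> V\<close> this
  then show False using girth[of e a "k - 1"] e k_pos by simp
qed

section \<open>The outlier automorphism in excess 1\<close>

context
  assumes k3: "3 \<le> k" and excess_one: "card V = 2 ^ Suc k"
begin

definition out :: "'a \<Rightarrow> 'a" where
  "out u = the_elem (outliers u)"

lemma outliers_eq: "u \<in> V \<Longrightarrow> outliers u = {out u}"
proof -
  assume "u \<in> V"
  then have "card (outliers u) = 1" using card_outliers[of u] excess_one by simp
  then obtain v where "outliers u = {v}" by (rule card_1_singletonE)
  then show ?thesis by (simp add: out_def)
qed

lemma out_V: "u \<in> V \<Longrightarrow> out u \<in> V"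
  using outliers_eq[of u] by (auto simp: outliers_def)

lemma out_notin_ball: "u \<in> V \<Longrightarrow> out u \<notin> B k u"
  using outliers_eq[of u] by (auto simp: outliers_def)

lemma in_ball_or_out: "u \<in> V \<Longrightarrow> v \<in> V \<Longrightarrow> v \<in> B k u \<or> v = out u"
  using outliers_eq[of u] by (auto simp: outliers_def)

lemma card_preds: "v \<in> V \<Longrightarrow> card (preds v) = 2"
  using excess_one_regular[OF k3 excess_one] by (simp add: defect_def)

text \<open>All in-degrees are 2, so \<open>outlier_exchange\<close> reads AO = OA, where each row
  of O has a single 1.\<close>

lemma out_arc:
  assumes u: "u \<in> V" and w: "w \<in> N u" shows "out w \<in> N (out u)"
proof -
  have wV: "w \<in> V" using N_in_V[OF u w] .
  have "w \<in> {x \<in> N u. out w \<in> outliers x}" using w outliers_eq[OF wV] by simp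
  then have "card {x \<in> N u. out w \<in> outliers x} \<noteq> 0" using finite_N[OF u] by auto
  then have "card (preds (out w) \<inter> outliers u) > 0"
    using outlier_exchange[OF u out_V[OF wV]] card_preds[OF out_V[OF wV]] by linarith
  then have "preds (out w) \<inter> outliers u \<noteq> {}" by (metis card.empty less_irrefl)
  then show ?thesis using outliers_eq[OF u] by (auto simp: preds_iff)
qed

text \<open>With zero defects every column of O sums to the excess 1.\<close>

lemma out_inj: assumes "x \<in> V" "y \<in> V" "out x = out y" shows "x = y"
proof -
  let ?v = "out x"
  have "card (misses ?v) = 1"
    using card_misses[OF out_V[OF assms(1)]] excess_one excess_one_regular[OF k3 excess_one] by simp
  moreover have "{x, y} \<subseteq> misses ?v"
    using assms outliers_eq by (simp add: misses_def)
  ultimately show ?thesis by (auto simp: card_1_singleton_iff)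
qed

lemma out_N: assumes "u \<in> V" "N u = {a, b}" "a \<noteq> b" shows "N (out u) = {out a, out b}"
proof -
  have ab: "a \<in> V" "b \<in> V" using N_subset[OF assms(1)] assms(2) by auto
  have "{out a, out b} \<subseteq> N (out u)" using out_arc[OF assms(1)] assms(2) by auto
  moreover have "out a \<noteq> out b" using out_inj[OF ab] assms(3) by blast
  then have "card {out a, out b} = 2" by simp
  ultimately show ?thesis
    using card_N[OF out_V[OF assms(1)]] finite_N[OF out_V[OF assms(1)]] by (metis card_subset_eq)
qed

lemma sibling_out:
  assumes u: "u \<in> V" and N: "N u = {a, b}" "a \<noteq> b" shows "out b \<in> B (k - 1) a"
proof -
  have "b \<in> V" using N_subset[OF u] N by auto
  then show ?thesis using sibling_outlier[OF k3 u N] outliers_eq by auto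
qed

text \<open>Let e be the outlier of b. The level at distance k from b consists of u,
  \<open>out u\<close> and the ball of a without e. With \<open>out u\<close> standing in for e, the
  signs alternate along the ball of a, except possibly below e. If e is on the last level,
  \<open>alt_sum k\<close> would be 1; otherwise comparing alternating sums leaves only k = 3, where
  e lies in \<open>B 1 a\<close>.\<close>

lemma sibling_out_near:
  assumes u: "u \<in> V" and N: "N u = {a, b}" "a \<noteq> b"
  shows "out b \<in> B 1 a"
proof (rule ccontr)
  define e where "e = out b"
  assume "out b \<notin> B 1 a"
  then have e1: "e \<notin> B 1 a" and ea: "e \<noteq> a" using out_ball_self[of a N 1] by (auto simp: e_def)
  have ab: "a \<in> V" "b \<in> V" using N_subset[OF u] N by auto
  have k2: "2 \<le> k" using k3 by simp
  obtain c c' where c: "N b = {c, c'}" "c \<noteq> c'" using obtain_N[OF ab(2)] .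
  have cV: "c \<in> V" "c' \<in> V" using N_subset[OF ab(2)] c by auto
  have eV: "e \<in> V" using out_V[OF ab(2)] by (simp add: e_def)
  have eA: "e \<in> B (k - 1) a" using sibling_out[OF u N] by (simp add: e_def)
  let ?A = "B (k - 1) a" and ?D = "B k b - B (k - 1) b" and ?f = "sign c c'"
  note level = outer_level[OF ab(2) c k2]
  note disj = ball_disjoint_k[OF u N]
  have e_arc: "e \<in> N (out u)" using out_arc[OF u, of b] N by (simp add: e_def)
  have Bk: "B k u = insert u (?A \<union> B (k - 1) b)" using ball_k_iff N by auto
  have ou: "out u \<notin> insert u (?A \<union> B (k - 1) b)" using out_notin_ball[OF u] Bk by simp
  have "?D = V - B (k - 1) b - {e}"
    using in_ball_or_out[OF ab(2)] ball_subset_V[OF ab(2), of k] out_notin_ball[OF ab(2)]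
    by (auto simp: e_def)
  moreover have "V = insert (out u) (insert u (?A \<union> B (k - 1) b))"
    using in_ball_or_out[OF u] ball_subset_V[OF u, of k] out_V[OF u] Bk by auto
  ultimately have D: "?D = insert (out u) (insert u (?A - {e}))"
    using disj ou eA by auto
  have mem: "z \<in> rim c \<union> rim c' \<longleftrightarrow> z = out u \<or> z = u \<or> z \<in> ?A \<and> z \<noteq> e" for z
    unfolding level[symmetric] D by blast
  have fin: "finite ?A" using finite_ball ab by simp
  have sum0: "?f (out u) + (?f u + sum ?f (?A - {e})) = 0"
    using sum_sign[OF ab(2) c k2] ou disj(1) fin unfolding level[symmetric] D by simp
  \<comment> \<open>A parent of e in the ball of a and \<open>out u\<close> share the child e, so
    their signs are opposite. Giving e the sign of \<open>out u\<close> therefore continues the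
    alternation into e.\<close>
  define g where "g = ?f(e := ?f (out u))"
  have "sum g ?A = g e + sum g (?A - {e})"
    using fin eA by (rule sum.remove)
  also have "sum g (?A - {e}) = sum ?f (?A - {e})"
    by (intro sum.cong) (auto simp: g_def)
  finally have total: "?f u + sum g ?A = 0" using sum0 by (simp add: g_def)
  have unit: "\<bar>?f z\<bar> = 1" if "z \<in> ?D" for z
    using sign_cases[OF ab(2) c k2, of z] that unfolding level by auto
  have fu: "?f a = - ?f u"
    by (rule sign_arc[OF ab(2) c k2], unfold mem) (use N ea in auto)
  have ga: "g a = - ?f u" using fu ea by (simp add: g_def)
  have arcs: "g z = - g x" if "x \<in> ?A" "z \<in> ?A" "x \<noteq> e" "z \<in> N x" for x z
  proof (cases "z = e")
    case True
    have "x \<noteq> out u" using that(1) ou by auto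
    have "?f x = - ?f (out u)"
      by (rule sign_coparents[OF ab(2) c k2, where z = e], unfold mem) (use that True e_arc \<open>x \<noteq> out u\<close> in auto)
    then show ?thesis using True that by (simp add: g_def)
  next
    case False
    have "?f z = - ?f x"
      by (rule sign_arc[OF ab(2) c k2 _ _ that(4)], unfold mem) (use that False in auto)
    then show ?thesis using False that by (simp add: g_def)
  qed
  have fu1: "\<bar>?f u\<bar> = 1" and fo1: "\<bar>?f (out u)\<bar> = 1"
    by (rule unit, unfold D, simp)+
  show False
  proof (cases "e \<in> B (k - 2) a")
    case False
    then have rim: "e \<in> rim a" using eA by (simp add: rim_def)
    have "sum g ?A = g a * alt_sum (Suc (k - 1))"
    proof (rule alternating_sum[OF ab(1)])
      fix x z assume xz: "x \<in> ?A" "z \<in> N x" "z \<in> ?A"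
      then have "x \<noteq> e" using rim_step[OF ab(1) rim] by auto
      then show "g z = - g x" using arcs xz by blast
    qed simp
    then have "?f u * (1 - alt_sum k) = 0" using total ga k_pos by (simp add: algebra_simps)
    then have "alt_sum k = 1" using fu1 by auto
    then show False using alt_sum_neq_unit[OF k3] by simp
  next
    case True
    have Ne: "N e = {out c, out c'}" using out_N[OF ab(2) c] by (simp add: e_def)
    have oc_neq: "out c \<noteq> out c'" using out_inj[OF cV] c(2) by auto
    have kk: "Suc (k - 2) = k - 1" "Suc (Suc (k - 2)) = k" using k2 by auto
    have step: "z \<in> ?A" if "z \<in> N e" for z
      using out_ball_step[OF True that] unfolding kk .
    have inner: "B (k - 2) d \<subseteq> B (k - 1) b" if "d \<in> N b" for d
    proof -
      have "k - 1 = Suc (k - 2)" using k2 by simp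
      then show ?thesis using that by (auto simp: out_ball_Suc)
    qed
    \<comment> \<open>\<open>sibling_out\<close> puts the outlier of each child of b within k - 1
      steps of the other child; as it is in the ball of a, it can only be on the last level. So the
      children of e lie in opposite halves and their subtrees cancel.\<close>
    have "out c \<in> rim c'"
      using sibling_out[OF ab(2), of c' c] c step[of "out c"] inner[of c'] disj(3) Ne
      by (auto simp: rim_def)
    moreover have "out c' \<in> rim c"
      using sibling_out[OF ab(2), of c c'] c step[of "out c'"] inner[of c] disj(3) Ne
      by (auto simp: rim_def)
    ultimately have "?f (out c) + ?f (out c') = 0"
      using rims_disjoint[OF ab(2) c k2] by (auto simp: sign_def)
    moreover have "out c \<noteq> e" "out c' \<noteq> e"
      using girth[OF eV, of _ 0] Ne k_pos by auto
    ultimately have g0: "g (out c) + g (out c') = 0" by (simp add: g_def)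
    have ge: "\<bar>g e\<bar> = 1" using fo1 by (simp add: g_def)
    obtain m s where ms: "0 < m" "m \<le> k - 2" "\<bar>s\<bar> = 1"
        "sum g ?A = g a * alt_sum k + 2 * s * alt_sum m"
      using alternating_sum_with_break[of e "out c" "out c'" g ?A a "k - 2",
          OF eV Ne oc_neq g0 ge arcs ab(1)] True ea unfolding kk by auto
    have ak: "alt_sum k = 1 - 2 * alt_sum (k - 1)" using alt_sum.simps(2)[of "k - 1"] k_pos by simp
    have "?f u + (- ?f u * (1 - 2 * alt_sum (k - 1)) + 2 * s * alt_sum m) = 0"
      using total unfolding ms(4) ga ak .
    then have "?f u * alt_sum (k - 1) = - s * alt_sum m"
      by (simp add: algebra_simps)
    then have "\<bar>?f u\<bar> * \<bar>alt_sum (k - 1)\<bar> = \<bar>s\<bar> * \<bar>alt_sum m\<bar>"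
      by (metis abs_minus_cancel abs_mult)
    then have "\<bar>alt_sum (k - 1)\<bar> = \<bar>alt_sum m\<bar>" using fu1 ms(3) by simp
    then have "k - 1 = 2" using ms k3 by (intro alt_sum_abs_eq[of "k - 1" m]) auto
    then have "k - 2 = 1" by simp
    then show False using True e1 by simp
  qed
qed

text \<open>By \<open>sibling_out_near\<close> the outlier of b is a or a child of a, and a itself
  is ruled out. Let x, y be the predecessors of v, with second children v', v''. Both v' and v'' are
  predecessors of \<open>out v\<close>, hence among \<open>out x\<close> and \<open>out y\<close>,
  and v'' must be \<open>out x\<close>. Then \<open>out v'\<close> is a common child of the siblings
  v and v''.\<close>

lemma no_excess_one: False
proof -
  have not_sibling: "out b \<noteq> a" if u: "u \<in> V" and N: "N u = {a, b}" "a \<noteq> b" for u a b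
  proof
    assume eq: "out b = a"
    have ab: "a \<in> V" "b \<in> V" using N_subset[OF u] N by auto
    obtain c c' where c: "N b = {c, c'}" "c \<noteq> c'" using obtain_N[OF ab(2)] .
    have "out c' \<in> N a" using out_N[OF ab(2) c] eq by simp
    then have "out c' \<in> B 1 a" by (simp add: out_ball_Suc)
    moreover have "out c' \<in> B 1 c" by (rule sibling_out_near[OF ab(2) c])
    then have "out c' \<in> B 2 b" using c by (auto simp: out_ball_Suc numeral_2_eq_2)
    ultimately show False using ball_disjoint[OF u, of a b 1 2] N k3 by auto
  qed
  have near: "out b \<in> N a" if "u \<in> V" "N u = {a, b}" "a \<noteq> b" for u a b
    using sibling_out_near[OF that] not_sibling[OF that] by (auto simp: out_ball_Suc)
  have "V \<noteq> {}" using excess_one by auto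
  then obtain v where v: "v \<in> V" by auto
  obtain x y where xy: "preds v = {x, y}" "x \<noteq> y"
    using card_preds[OF v] unfolding card_2_iff by blast
  then have xyV: "x \<in> V" "y \<in> V" and arcs: "v \<in> N x" "v \<in> N y" by (auto simp: preds_def)
  obtain v' where v': "N x = {v, v'}" "v \<noteq> v'" using card_2_obtain_other[OF card_N[OF xyV(1)] arcs(1)] .
  obtain v'' where v'': "N y = {v, v''}" "v \<noteq> v''" using card_2_obtain_other[OF card_N[OF xyV(2)] arcs(2)] .
  have V: "v' \<in> V" "v'' \<in> V" using N_subset xyV v' v'' by auto
  have ov: "out v \<in> N v'" "out v \<in> N v''"
    using near[OF xyV(1), of v' v] near[OF xyV(2), of v'' v] v' v'' by auto
  have "{out x, out y} \<subseteq> preds (out v)"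
    using out_arc[OF xyV(1) arcs(1)] out_arc[OF xyV(2) arcs(2)] out_V xyV by (auto simp: preds_iff)
  moreover have "out x \<noteq> out y" using out_inj[OF xyV] xy(2) by blast
  then have "card {out x, out y} = 2" by simp
  ultimately have preds: "preds (out v) = {out x, out y}"
    using card_preds[OF out_V[OF v]] card_subset_eq[OF finite_preds] by metis
  have k1: "B (Suc 0) w \<subseteq> B k w" for w using k_pos by (intro out_ball_mono) simp
  have "v' \<noteq> out x" "v'' \<noteq> out y"
    using out_notin_ball[OF xyV(1)] out_notin_ball[OF xyV(2)] k1[of x] k1[of y] v' v''
    by (auto simp: out_ball_Suc)
  then have "v'' = out x"
    using preds ov V by (auto simp: set_eq_iff preds_iff)
  then have "out v' \<in> N v''" using out_arc[OF xyV(1), of v'] v' by simp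
  moreover have "out v' \<in> N v" using near[OF xyV(1), of v v'] v' by simp
  ultimately show False
    using ball_disjoint[OF xyV(2), of v v'' 1 1] v'' k3 by (auto simp: out_ball_Suc)
qed

end

end

section \<open>Excess two, length at least three\<close>

context binary_geodetic
begin

section \<open>Reductions from excess 2 to excess 1\<close>

lemma N_eqI: "u \<in> V \<Longrightarrow> x \<in> N u \<Longrightarrow> y \<in> N u \<Longrightarrow> x \<noteq> y \<Longrightarrow> N u = {x, y}"
  using card_subset_eq[OF finite_N, of u "{x, y}"] card_N[of u] by simp

text \<open>Every vertex misses p or q, so no ball of radius at most k contains both, and sending q
  to p is injective on balls. As p and q have the same children, the map commutes with forming
  balls, so ball sizes survive.\<close>

lemma amalgamate_clones:
  assumes pq: "p \<in> V" "q \<in> V" "p \<noteq> q" "N p = N q"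
    and hit: "\<And>u. u \<in> V \<Longrightarrow> outliers u \<inter> {p, q} \<noteq> {}"
  shows "binary_geodetic (V - {q}) (\<lambda>u. (\<lambda>x. if x = q then p else x) ` N u) k"
proof -
  define h where "h = (\<lambda>x. if x = q then p else x)"
  have h_id: "h u = u" if "u \<noteq> q" for u using that by (simp add: h_def)
  have N_h: "N (h u) = N u" for u using pq(4) by (simp add: h_def)
  have inj: "inj_on h A" if "\<not> {p, q} \<subseteq> A" for A
    using that by (auto simp: inj_on_def h_def)
  have ball_h: "out_ball (\<lambda>u. h ` N u) m (h u) = h ` B m u" for m u
    by (induction m arbitrary: u) (simp_all add: out_ball_Suc N_h image_UN)
  have not_both: "\<not> {p, q} \<subseteq> B m u" if "u \<in> V" "m \<le> k" for u m
    using hit[OF that(1)] out_ball_mono[OF that(2), of N u] by (auto simp: outliers_iff)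
  have "binary_geodetic (V - {q}) (\<lambda>u. h ` N u) k"
  proof
    show "finite (V - {q})" using finite_V by simp
    show "0 < k" by (rule k_pos)
    fix u assume u: "u \<in> V - {q}"
    then have uV: "u \<in> V" by simp
    show "h ` N u \<subseteq> V - {q}" using N_subset[OF uV] pq by (auto simp: h_def)
    have "N u \<subseteq> B (Suc 0) u" by (auto simp: out_ball_Suc)
    then have "\<not> {p, q} \<subseteq> N u" using not_both[OF uV, of "Suc 0"] k_pos by auto
    then show "card (h ` N u) = 2" using card_image[OF inj] card_N[OF uV] by simp
    have "out_ball (\<lambda>u. h ` N u) k u = h ` B k u" using ball_h[of k u] u h_id[of u] by simp
    then show "card (out_ball (\<lambda>u. h ` N u) k u) = 2 ^ Suc k - 1"
      using card_image[OF inj[OF not_both[OF uV order_refl]]] card_ball_k[OF uV] by simp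
  qed
  then show ?thesis unfolding h_def .
qed

context
  assumes k3: "3 \<le> k" and excess_two: "card V = 2 ^ Suc k + 1"
begin

lemma card_outliers_2: "u \<in> V \<Longrightarrow> card (outliers u) = 2"
  using card_outliers[of u] excess_two by simp

text \<open>A vertex of in-degree 0 lies in no ball of another vertex, so deleting it would leave a
  digraph of excess 1.\<close>

lemma no_source: assumes "p \<in> V" shows "preds p \<noteq> {}"
proof
  assume "preds p = {}"
  then have "N u \<subseteq> V - {p}" if "u \<in> V" for u
    using that N_subset[OF that] by (auto simp: preds_def)
  then interpret del: binary_geodetic "V - {p}" N k
    using finite_V card_N card_ball_k k_pos by unfold_locales auto
  show False using del.no_excess_one[OF k3] assms excess_two by simp
qed

lemma obtain_pred:
  assumes "x \<in> V"
  obtains u y where "u \<in> V" "N u = {x, y}" "x \<noteq> y" "y \<in> V"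
proof -
  obtain u where u: "u \<in> V" "x \<in> N u" using no_source[OF assms] by (auto simp: preds_iff)
  obtain y where "N u = {x, y}" "x \<noteq> y" using card_2_obtain_other[OF card_N[OF u(1)] u(2)] .
  then show ?thesis using that u N_subset[OF u(1)] by auto
qed

section \<open>Covering the vertices of in-degree 1 by outliers\<close>

lemma defect_poor: assumes "w \<in> poor" shows "defect w = 1"
proof -
  have "preds w \<noteq> {}" using no_source assms by (simp add: poor_def)
  then have "0 < card (preds w)" using finite_preds by (simp only: card_gt_0_iff) simp
  moreover have "0 < defect w" using assms by (simp add: poor_def)
  ultimately show ?thesis unfolding defect_def by linarith
qed

lemma poor_V: "w \<in> poor \<Longrightarrow> w \<in> V" and rich_V: "w \<in> rich \<Longrightarrow> w \<in> V"
  by (simp_all add: poor_def rich_def)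

lemma poor_rich_disjoint: "w \<in> poor \<Longrightarrow> w \<in> rich \<Longrightarrow> False"
  by (simp add: poor_def rich_def)

lemma sum_poor: "(\<Sum>w\<in>poor. defect w * g w) = (\<Sum>w\<in>poor. g w)"
  using defect_poor by (intro sum.cong) auto

lemma card_poor_eq: "int (card poor) = - (\<Sum>w\<in>rich. defect w)"
  using sum_poor_rich sum_poor[of "\<lambda>_. 1"] by simp

lemma poor_covered:
  assumes u: "u \<in> V" and N: "N u = {a, b}" shows "poor \<subseteq> outliers a \<union> outliers b"
proof
  fix w assume w: "w \<in> poor"
  have "0 < card {x \<in> N u. w \<in> outliers x}"
    using defect_le[OF u poor_V[OF w]] defect_poor[OF w] by linarith
  then have "{x \<in> N u. w \<in> outliers x} \<noteq> {}" by (metis card.empty less_irrefl)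
  then show "w \<in> outliers a \<union> outliers b" using N by auto
qed

lemma card_outlier_union: "a \<in> V \<Longrightarrow> b \<in> V \<Longrightarrow> card (outliers a \<union> outliers b) \<le> 4"
  using card_Un_le[of "outliers a" "outliers b"] card_outliers_2 by simp

lemma card_poor_le_4: "card poor \<le> 4"
proof -
  have "V \<noteq> {}" using excess_two by auto
  then obtain u where u: "u \<in> V" by auto
  obtain a b where ab: "N u = {a, b}" "a \<noteq> b" "a \<in> V" "b \<in> V" using obtain_N[OF u] .
  have "card poor \<le> card (outliers a \<union> outliers b)"
    using poor_covered[OF u ab(1)] by (intro card_mono) auto
  then show ?thesis using card_outlier_union[OF ab(3,4)] by simp
qed

text \<open>Apply \<open>sibling_outlier\<close> in both directions. The vertices found lie in the
  disjoint balls of the two children, so they differ and are reached from u.\<close>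

lemma sibling_outliers:
  assumes u: "u \<in> V" and N: "N u = {a, b}" "a \<noteq> b"
  obtains e e' where "e \<in> outliers b" "e' \<in> outliers a" "e \<noteq> e'"
    "e \<noteq> u" "e' \<noteq> u" "e \<notin> outliers u" "e' \<notin> outliers u"
proof -
  obtain e where e: "e \<in> outliers b" "e \<in> B (k - 1) a" using sibling_outlier[OF k3 u N] .
  have N': "N u = {b, a}" "b \<noteq> a" using N by auto
  obtain e' where e': "e' \<in> outliers a" "e' \<in> B (k - 1) b" using sibling_outlier[OF k3 u N'] .
  note disj = ball_disjoint_k[OF u N]
  have "e \<in> B k u" "e' \<in> B k u" using e e' N by (auto simp: ball_k_iff)
  then show ?thesis using that[of e e'] e e' disj by (auto simp: outliers_iff)
qed

text \<open>Four poor vertices would fill the outlier sets of any two siblings exactly, so every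
  outlier would be poor. For a poor p, the vertex p, its two outliers and the two vertices of
  \<open>sibling_outliers\<close> are then five poor vertices.\<close>

lemma card_poor_neq_4: "card poor \<noteq> 4"
proof
  assume card4: "card poor = 4"
  have sub: "outliers x \<subseteq> poor" if x: "x \<in> V" for x
  proof -
    obtain u y where u: "u \<in> V" "N u = {x, y}" "x \<noteq> y" "y \<in> V" using obtain_pred[OF x] .
    have "poor = outliers x \<union> outliers y"
      using poor_covered[OF u(1,2)] card_outlier_union[OF x u(4)] card4
      by (intro card_seteq) auto
    then show ?thesis by auto
  qed
  obtain p where p: "p \<in> poor" using card4 by fastforce
  have pV: "p \<in> V" using poor_V[OF p] .
  obtain a b where ab: "N p = {a, b}" "a \<noteq> b" "a \<in> V" "b \<in> V" using obtain_N[OF pV] .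
  obtain e e' where e: "e \<in> outliers b" "e' \<in> outliers a" "e \<noteq> e'"
    "e \<noteq> p" "e' \<noteq> p" "e \<notin> outliers p" "e' \<notin> outliers p"
    using sibling_outliers[OF pV ab(1,2)] .
  have "card (insert p (insert e (insert e' (outliers p)))) \<le> card poor"
    using p e sub[OF pV] sub[OF ab(3)] sub[OF ab(4)] by (intro card_mono) auto
  moreover have "card (insert p (insert e (insert e' (outliers p)))) = 5"
    using e card_outliers_2[OF pV] not_outlier_self[of p] by (simp add: card_insert_if)
  ultimately show False using card4 by simp
qed

text \<open>The unit q of the weight estimates: weights are 4q - 1 at distance 0, 2q - 1 at distance
  1 and q - 1 at distance 2.\<close>

definition quarter :: int where
  "quarter = 2 ^ (k - 2)"

lemma quarter_facts:
  "2 ^ k = 4 * quarter" "2 ^ (k - 1) = 2 * quarter" "2 \<le> quarter"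
  "2 * 2 ^ (k - 3) = quarter"
proof -
  obtain j where j: "k = Suc (Suc (Suc j))"
    using k3 by (metis Suc_le_D numeral_3_eq_3 Suc_le_mono)
  have q: "quarter = 2 * 2 ^ j" unfolding quarter_def by (simp add: j)
  show "2 ^ k = 4 * quarter" "2 ^ (k - 1) = 2 * quarter" "2 \<le> quarter"
    "2 * 2 ^ (k - 3) = quarter"
    unfolding q by (simp_all add: j)
qed

section \<open>Weight estimates at rich vertices\<close>

lemma misses_poor_le:
  assumes v: "v \<in> V" and A: "A \<subseteq> rich"
  shows "0 \<le> 2 + (\<Sum>w\<in>poor. weight k w v) + (\<Sum>w\<in>A. defect w * weight k w v)"
  using misses_le[OF v A] excess_two by (simp add: sum_poor)

lemma weight_poor_le: "w \<in> poor \<Longrightarrow> v \<in> rich \<Longrightarrow> weight k w v \<le> 2 * quarter - 1"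
  using weight_le_1[of v w] poor_rich_disjoint unfolding quarter_facts(2) by blast

lemma weight_poor_le':
  assumes "w \<in> poor" "v \<in> rich" "v \<notin> N w" shows "weight k w v \<le> quarter - 1"
proof -
  have "v \<noteq> w" using poor_rich_disjoint assms by auto
  then show ?thesis using weight_le_2[of v w] assms(3) k3 by (simp add: quarter_def)
qed

lemma weight_arc': "w \<in> V \<Longrightarrow> v \<in> N w \<Longrightarrow> weight k w v = 2 * quarter - 1"
  using weight_arc quarter_facts(2) by simp

lemma weight_self': "weight k v v = 4 * quarter - 1"
  using weight_self quarter_facts(1) by simp

text \<open>With q = \<open>quarter\<close>, a defect of -2 or less costs at least 2(4q - 1), while
  three poor vertices and the excess return at most 3(2q - 1) + 2.\<close>

lemma defect_rich:
  assumes r: "r \<in> rich" and card3: "card poor \<le> 3"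
  shows "defect r = - 1"
proof (rule ccontr)
  assume "defect r \<noteq> - 1"
  then have "defect r \<le> - 2" using r by (simp add: rich_def)
  then have "defect r * (4 * quarter - 1) \<le> - 2 * (4 * quarter - 1)"
    using quarter_facts(3) by (intro mult_right_mono) auto
  then have 1: "defect r * weight k r r \<le> 2 - 8 * quarter" unfolding weight_self' by simp
  have "(\<Sum>w\<in>poor. weight k w r) \<le> (\<Sum>w\<in>poor. 2 * quarter - 1)"
    by (intro sum_mono weight_poor_le r)
  also have "\<dots> = int (card poor) * (2 * quarter - 1)" by simp
  also have "\<dots> \<le> 3 * (2 * quarter - 1)"
    using card3 quarter_facts(3) by (intro mult_right_mono) auto
  finally have 2: "(\<Sum>w\<in>poor. weight k w r) \<le> 6 * quarter - 3" by simp
  have "0 \<le> 2 + (\<Sum>w\<in>poor. weight k w r) + defect r * weight k r r"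
    using misses_poor_le[OF rich_V[OF r], of "{r}"] r by simp
  then show False using 1 2 quarter_facts(3) by linarith
qed

lemma card_rich: "card poor \<le> 3 \<Longrightarrow> card rich = card poor"
  using card_poor_eq defect_rich by simp

text \<open>Nonnegativity of \<open>card (misses r)\<close> rearranged; the constant is the weight
  of r on itself minus the excess 2.\<close>

lemma poor_sum_ge:
  assumes r: "r \<in> rich" and card3: "card poor \<le> 3" and A: "A \<subseteq> rich - {r}"
  shows "4 * quarter - 3 + (\<Sum>w\<in>A. weight k w r) \<le> (\<Sum>w\<in>poor. weight k w r)"
proof -
  have fin: "finite A" using A finite_rich by (meson finite_Diff finite_subset)
  have "0 \<le> 2 + (\<Sum>w\<in>poor. weight k w r) + (\<Sum>w\<in>insert r A. defect w * weight k w r)"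
    using r A by (intro misses_poor_le rich_V) auto
  also have "(\<Sum>w\<in>insert r A. defect w * weight k w r) = (\<Sum>w\<in>insert r A. - weight k w r)"
    using r A defect_rich card3 by (intro sum.cong) auto
  also have "\<dots> = - (4 * quarter - 1) - (\<Sum>w\<in>A. weight k w r)"
    using A fin by (subst sum.insert) (auto simp: weight_self' sum_negf)
  finally show ?thesis by simp
qed

lemma card_poor_neq_1: "card poor \<noteq> 1"
proof
  assume 1: "card poor = 1"
  then obtain p where p: "poor = {p}" by (rule card_1_singletonE)
  have "card rich = 1" using card_rich 1 by simp
  then obtain r where r: "rich = {r}" by (rule card_1_singletonE)
  have "4 * quarter - 3 \<le> weight k p r" using poor_sum_ge[of r "{}"] 1 p r by simp
  then show False using weight_poor_le[of p r] p r quarter_facts(3) by simp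
qed

text \<open>If one of the two poor vertices had no arc to r, their weights at r would sum to at most
  3q - 2, short of the required 4q - 3 (with q = \<open>quarter\<close>).\<close>

lemma clones_of_two:
  assumes poor: "poor = {p, q}" "p \<noteq> q"
  shows "\<exists>a b. rich = {a, b} \<and> a \<noteq> b \<and> N p = {a, b} \<and> N q = {a, b}"
proof -
  have card2: "card poor = 2" using poor by simp
  then have "card rich = 2" using card_rich by simp
  then obtain a b where ab: "rich = {a, b}" "a \<noteq> b" unfolding card_2_iff by blast
  have arc: "r \<in> N w" if r: "r \<in> rich" and w: "poor = {w, w'}" "w \<noteq> w'" for r w w'
  proof (rule ccontr)
    assume "r \<notin> N w"
    then have "weight k w r \<le> quarter - 1" using weight_poor_le' r w by blast
    moreover have "weight k w' r \<le> 2 * quarter - 1" using weight_poor_le r w by blast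
    moreover have "4 * quarter - 3 \<le> weight k w r + weight k w' r"
      using poor_sum_ge[OF r, of "{}"] card2 w by simp
    ultimately show False using quarter_facts(3) by linarith
  qed
  have "poor = {q, p}" "q \<noteq> p" using poor by auto
  then have "rich \<subseteq> N p" "rich \<subseteq> N q" using arc poor by blast+
  moreover have "p \<in> V" "q \<in> V" using poor_V poor by auto
  ultimately have "N p = rich" "N q = rich"
    using card_N finite_N \<open>card rich = 2\<close> by (metis card_subset_eq)+
  then show ?thesis using ab by auto
qed

section \<open>Exactly two vertices of in-degree 1\<close>

context
  fixes p q a b
  assumes poor: "poor = {p, q}" "p \<noteq> q" and rich: "rich = {a, b}" "a \<noteq> b"
    and Np: "N p = {a, b}" and Nq: "N q = {a, b}"
begin

lemma pqab_V: "p \<in> V" "q \<in> V" "a \<in> V" "b \<in> V"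
  using poor rich poor_V[of p] poor_V[of q] rich_V[of a] rich_V[of b] by simp_all

lemma misses_eq_two:
  assumes "v \<in> V"
  shows "int (card (misses v)) = 2 + weight k p v + weight k q v - weight k a v - weight k b v"
proof -
  have "card poor \<le> 3" using poor by simp
  then have "defect a = - 1" "defect b = - 1" using defect_rich rich by auto
  moreover have "defect p = 1" "defect q = 1" using defect_poor poor by auto
  ultimately show ?thesis
    using card_misses[OF assms] excess_two poor rich
    by (simp add: sum_defect_split)
qed

text \<open>None of a, b, q reaches p within k - 1 steps, so only its own weight 2^k - 1 adds to the
  excess. Together p and q are missed \<open>card V\<close> + 1 times.\<close>

lemma card_misses_p: "card (misses p) = 2 ^ k + 1"
proof -
  have "p \<notin> B (k - 1) a" "p \<notin> B (k - 1) b" using ball_disjoint_k[OF pqab_V(1) Np rich(2)] by auto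
  moreover have "p \<in> outliers q" using clone_outlier[OF pqab_V(2,1)] poor(2) Np Nq by simp
  then have "p \<notin> B (k - 1) q" using in_ball_mono[of p N "k - 1" q k] by (auto simp: outliers_iff)
  ultimately have "int (card (misses p)) = 2 ^ k + 1"
    using misses_eq_two[OF pqab_V(1)] by (simp add: weight_far weight_self)
  then have "int (card (misses p)) = int (2 ^ k + 1)" by simp
  then show ?thesis by (simp only: of_nat_eq_iff)
qed

lemma card_misses_a: "card (misses a) = 1"
proof -
  have "a \<notin> B (k - 1) b"
    using ball_disjoint_k(3)[OF pqab_V(1) Np rich(2)] out_ball_self[of a N "k - 1"] by blast
  then have "int (card (misses a)) = 2 + (2 * quarter - 1) + (2 * quarter - 1) - (4 * quarter - 1) - 0"
    using misses_eq_two[OF pqab_V(3)] weight_arc'[OF pqab_V(1), of a] weight_arc'[OF pqab_V(2), of a] Np Nq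
    by (simp add: weight_far weight_self')
  then show ?thesis by simp
qed

text \<open>Of the three predecessors of a exactly p and q are outliers of w, so
  \<open>outlier_exchange\<close> leaves one child of w that misses a; by
  \<open>card_misses_a\<close> no other vertex misses a.\<close>

lemma child_missing_a:
  assumes w: "w \<in> V" "outliers w = {p, q}"
  obtains x where "x \<in> N w" "misses a = {x}"
proof -
  have "card (preds a) = 3" using defect_rich[of a] rich poor by (simp add: defect_def)
  moreover have "preds a \<inter> outliers w = {p, q}"
    using w(2) Np Nq pqab_V by (auto simp: preds_iff)
  ultimately have "card {x \<in> N w. a \<in> outliers x} = 1"
    using outlier_exchange[OF w(1) pqab_V(3)] poor(2) by simp
  then obtain x where "{x \<in> N w. a \<in> outliers x} = {x}" by (rule card_1_singletonE)
  then have x: "x \<in> N w" "a \<in> outliers x" by auto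
  moreover obtain y where "misses a = {y}" using card_misses_a by (auto simp: card_1_singleton_iff)
  moreover have "x \<in> misses a" using x N_in_V[OF w(1)] by (auto simp: misses_def)
  ultimately show ?thesis using that by auto
qed

lemma child_missing_p:
  assumes w: "w \<in> V" "outliers w = {p, q}"
  obtains x where "x \<in> N w" "p \<in> outliers x"
proof -
  have "p \<in> poor" using poor by simp
  then have "0 < card {x \<in> N w. p \<in> outliers x}"
    using defect_le[OF w(1) pqab_V(1)] defect_poor by simp
  then have "{x \<in> N w. p \<in> outliers x} \<noteq> {}" by (metis card.empty less_irrefl)
  then show ?thesis using that by auto
qed

end

lemma card_poor_neq_2: "card poor \<noteq> 2"
proof
  assume "card poor = 2"
  then obtain p q where poor: "poor = {p, q}" "p \<noteq> q" unfolding card_2_iff by blast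
  obtain a b where rich: "rich = {a, b}" "a \<noteq> b" and Np: "N p = {a, b}" and Nq: "N q = {a, b}"
    using clones_of_two[OF poor] by blast
  have poor': "poor = {q, p}" "q \<noteq> p" and rich': "rich = {b, a}" "b \<noteq> a"
    and Np': "N p = {b, a}" and Nq': "N q = {b, a}"
    using poor rich Np Nq by auto
  note V = pqab_V[OF poor rich Np Nq]
  define both where "both = {w \<in> V. outliers w = {p, q}}"
  have both_V: "w \<in> V" "outliers w = {p, q}" "outliers w = {q, p}" if "w \<in> both" for w
    using that by (auto simp: both_def)
  \<comment> \<open>The only vertex x missing a and the only vertex y missing b are children of
    every vertex in \<open>both\<close>. If x and y differ, two such vertices are clones, so w' is
    an outlier of w and thus of itself. If x = y, the other child of w is in \<open>both\<close> too
    and has its sibling x as a child.\<close>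
  have unique: "w = w'" if w: "w \<in> both" and w': "w' \<in> both" for w w'
  proof (rule ccontr)
    assume "w \<noteq> w'"
    obtain x where x: "x \<in> N w" "misses a = {x}"
      using child_missing_a[OF poor rich Np Nq both_V(1,2)[OF w]] .
    obtain y where y: "y \<in> N w" "misses b = {y}"
      using child_missing_a[OF poor rich' Np' Nq' both_V(1,2)[OF w]] .
    have xV: "x \<in> V" using N_in_V[OF both_V(1)[OF w] x(1)] .
    have in_N: "x \<in> N z" "y \<in> N z" if z: "z \<in> both" for z
    proof -
      obtain x' where "x' \<in> N z" "misses a = {x'}"
        using child_missing_a[OF poor rich Np Nq both_V(1,2)[OF z]] .
      then show "x \<in> N z" using x(2) by simp
      obtain y' where "y' \<in> N z" "misses b = {y'}"
        using child_missing_a[OF poor rich' Np' Nq' both_V(1,2)[OF z]] .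
      then show "y \<in> N z" using y(2) by simp
    qed
    show False
    proof (cases "x = y")
      case False
      have N_both: "N z = {x, y}" if z: "z \<in> both" for z
      proof -
        obtain z' where "N z = {x, z'}"
          using card_2_obtain_other[OF card_N[OF both_V(1)[OF z]] in_N(1)[OF z]] .
        then show ?thesis using in_N(2)[OF z] False by auto
      qed
      have "w' \<in> outliers w"
        using clone_outlier[OF both_V(1)[OF w] both_V(1)[OF w'] \<open>w \<noteq> w'\<close>] N_both w w' by simp
      then have "w' \<in> outliers w'" using both_V(2) w w' by simp
      then show False using not_outlier_self by blast
    next
      case True
      have "a \<in> outliers x" "b \<in> outliers x" using x(2) y(2) True by (auto simp: misses_def)
      then have "outliers x = {a, b}"
        using card_outliers_2[OF xV] rich(2) card_seteq[of "outliers x" "{a, b}"] by auto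
      then have not_x: "p \<notin> outliers x" "q \<notin> outliers x"
        using poor_rich_disjoint poor rich by auto
      obtain z where z: "N w = {x, z}" "x \<noteq> z"
        using card_2_obtain_other[OF card_N[OF both_V(1)[OF w]] x(1)] .
      have zV: "z \<in> V" using N_in_V[OF both_V(1)[OF w]] z by auto
      obtain z' where "z' \<in> N w" "p \<in> outliers z'"
        using child_missing_p[OF poor rich Np Nq both_V(1,2)[OF w]] .
      then have "p \<in> outliers z" using not_x(1) z(1) by auto
      obtain z'' where "z'' \<in> N w" "q \<in> outliers z''"
        using child_missing_p[OF poor' rich Nq Np both_V(1,3)[OF w]] .
      then have "q \<in> outliers z" using not_x(2) z(1) by auto
      note \<open>p \<in> outliers z\<close> this
      then have "outliers z = {p, q}"
        using card_outliers_2[OF zV] poor(2) card_seteq[of "outliers z" "{p, q}"] by auto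
      then have "x \<in> N z" using in_N(1)[of z] zV by (simp add: both_def)
      then have "x \<in> B 1 z" by (simp add: out_ball_Suc)
      then show False
        using ball_disjoint[OF both_V(1)[OF w], of x z 0 1] z k3 by auto
    qed
  qed
  have card_both: "card both \<le> 1"
    using unique finite_V by (auto simp: card_le_Suc0_iff_eq both_def)
  \<comment> \<open>In all, p and q are missed \<open>card V\<close> + 1 times and at most one
    vertex misses both, so a vertex missing neither would leave too few.\<close>
  have hit: "outliers u \<inter> {p, q} \<noteq> {}" if u: "u \<in> V" for u
  proof
    assume none: "outliers u \<inter> {p, q} = {}"
    have "card (misses p) + card (misses q) = (\<Sum>w\<in>V. card (outliers w \<inter> {p, q}))"
    proof -
      have "card (misses x) = (\<Sum>w\<in>V. of_bool (x \<in> outliers w))" for x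
        using finite_V by (simp add: misses_def Collect_conj_eq)
      then have "card (misses p) + card (misses q)
          = (\<Sum>w\<in>V. of_bool (p \<in> outliers w) + of_bool (q \<in> outliers w))"
        by (simp only: sum.distrib)
      also have "\<dots> = (\<Sum>w\<in>V. card (outliers w \<inter> {p, q}))"
        using poor(2) by (intro sum.cong) (auto simp: Int_insert_right)
      finally show ?thesis .
    qed
    also have "\<dots> = (\<Sum>w\<in>V - {u}. card (outliers w \<inter> {p, q}))"
      using none u finite_V by (simp add: sum.remove[of V u])
    also have "\<dots> \<le> (\<Sum>w\<in>V - {u}. 1 + of_bool (w \<in> both))"
    proof (rule sum_mono)
      fix w assume w: "w \<in> V - {u}"
      show "card (outliers w \<inter> {p, q}) \<le> 1 + of_bool (w \<in> both)"
      proof (cases "p \<in> outliers w \<and> q \<in> outliers w")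
        case True
        then have "outliers w = {p, q}"
          using card_outliers_2[of w] w poor(2) card_seteq[of "outliers w" "{p, q}"] by auto
        then show ?thesis using w poor(2) by (simp add: both_def)
      next
        case False
        then show ?thesis by (auto simp: Int_insert_right)
      qed
    qed
    also have "\<dots> = card (V - {u}) + card ((V - {u}) \<inter> both)"
      unfolding sum.distrib using finite_V by simp
    also have "\<dots> \<le> card (V - {u}) + card both"
      using finite_V by (intro add_left_mono card_mono) (auto simp: both_def)
    also have "\<dots> \<le> card V"
      using card_both u finite_V excess_two by (simp add: card_Diff_singleton)
    finally show False
      using card_misses_p[OF poor rich Np Nq] card_misses_p[OF poor' rich Nq Np] excess_two by simp
  qed
  interpret amalg: binary_geodetic "V - {q}" "\<lambda>u. (\<lambda>x. if x = q then p else x) ` N u" k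
    using amalgamate_clones[OF V(1,2) poor(2) _ hit] Np Nq by simp
  show False
    using amalg.no_excess_one[OF k3] V(2) excess_two by simp
qed

section \<open>Exactly three vertices of in-degree 1\<close>

context
  assumes card3: "card poor = 3"
begin

lemma card_preds_rich: "r \<in> rich \<Longrightarrow> card (preds r) = 3"
  using defect_rich[of r] card3 by (simp add: defect_def)

lemma card_rich_3: "card rich = 3"
  using card_rich card3 by simp

text \<open>Two siblings must cover the three poor vertices by outliers, and the sibling of x
  supplies only two.\<close>

lemma outliers_meet_poor: assumes x: "x \<in> V" shows "outliers x \<inter> poor \<noteq> {}"
proof
  assume none: "outliers x \<inter> poor = {}"
  obtain u y where u: "u \<in> V" "N u = {x, y}" "x \<noteq> y" "y \<in> V" using obtain_pred[OF x] .
  have "poor \<subseteq> outliers y" using poor_covered[OF u(1,2)] none by auto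
  then have "card poor \<le> card (outliers y)" by (intro card_mono) auto
  then show False using card_outliers_2[OF u(4)] card3 by simp
qed

text \<open>At least one is missed, since s does not miss itself. If both were, the two vertices of
  \<open>sibling_outliers\<close> would not be poor, and with the three poor vertices they would
  exceed the at most four outliers of the children of s.\<close>

lemma poor_dichotomy:
  assumes poor: "poor = {s, x, y}" shows "x \<in> outliers s \<longleftrightarrow> y \<notin> outliers s"
proof -
  have s: "s \<in> V" using poor poor_V[of s] by simp
  have "x \<notin> outliers s \<or> y \<notin> outliers s"
  proof (rule ccontr)
    assume "\<not> ?thesis"
    then have both: "x \<in> outliers s" "y \<in> outliers s" by auto
    obtain a b where ab: "N s = {a, b}" "a \<noteq> b" "a \<in> V" "b \<in> V" using obtain_N[OF s] .
    obtain e e' where e: "e \<in> outliers b" "e' \<in> outliers a" "e \<noteq> e'"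
      "e \<noteq> s" "e' \<noteq> s" "e \<notin> outliers s" "e' \<notin> outliers s"
      using sibling_outliers[OF s ab(1,2)] .
    have fresh: "e \<notin> poor" "e' \<notin> poor" using e both poor by auto
    have "card (insert e (insert e' poor)) \<le> card (outliers a \<union> outliers b)"
      using e poor_covered[OF s ab(1)] by (intro card_mono) auto
    moreover have "card (insert e (insert e' poor)) = 5"
      using fresh e(3) card3 by (simp add: card_insert_if)
    ultimately show False using card_outlier_union[OF ab(3,4)] by simp
  qed
  moreover have "x \<in> outliers s \<or> y \<in> outliers s"
    using outliers_meet_poor[OF s] poor not_outlier_self[of s] by auto
  ultimately show ?thesis by blast
qed

lemma rich_outlier_pred:
  assumes u: "u \<in> V" and r: "r \<in> rich" shows "preds r \<inter> outliers u \<noteq> {}"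
proof -
  have "0 < card (preds r \<inter> outliers u)"
    using outlier_exchange[OF u rich_V[OF r]] card_preds_rich[OF r] by linarith
  then show ?thesis by (metis card.empty less_irrefl)
qed

text \<open>By \<open>rich_outlier_pred\<close> the two outliers of u have all three rich vertices
  among their children, so one of them has two.\<close>

lemma outlier_into_rich:
  assumes u: "u \<in> V" obtains w where "w \<in> outliers u" "N w \<subseteq> rich"
proof -
  obtain x y where xy: "outliers u = {x, y}" "x \<noteq> y"
    using card_outliers_2[OF u] unfolding card_2_iff by blast
  have "x \<in> outliers u" "y \<in> outliers u" using xy by auto
  then have V: "x \<in> V" "y \<in> V" by (simp_all add: outliers_iff)
  have small: "card (N z \<inter> rich) \<le> 1" if "\<not> N z \<subseteq> rich" "z \<in> V" for z
  proof -
    have "N z \<inter> rich \<subset> N z" using that by auto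
    then have "card (N z \<inter> rich) < card (N z)" using finite_N[OF that(2)] by (rule psubset_card_mono[rotated])
    then show ?thesis using card_N[OF that(2)] by simp
  qed
  have "rich \<subseteq> N x \<union> N y"
    using rich_outlier_pred[OF u] xy by (force simp: preds_iff)
  then have "rich = (N x \<inter> rich) \<union> (N y \<inter> rich)" by auto
  then have "3 \<le> card (N x \<inter> rich) + card (N y \<inter> rich)"
    using card_Un_le[of "N x \<inter> rich" "N y \<inter> rich"] card_rich_3 by simp
  then have "N x \<subseteq> rich \<or> N y \<subseteq> rich" using small[OF _ V(1)] small[OF _ V(2)] by linarith
  then show ?thesis using that xy by auto
qed

text \<open>
  If r has only one predecessor p of in-degree 1, then the count of vertices missing r is
  nonnegative only if the other two vertices of in-degree 1 reach r in two steps.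
\<close>
definition hub :: "'a \<Rightarrow> 'a \<Rightarrow> bool" where
  "hub r p \<longleftrightarrow> p \<in> poor \<and> r \<in> N p \<and>
    (\<forall>s\<in>poor - {p}. \<exists>x\<in>V. x \<in> N s \<and> r \<in> N x \<and> x \<notin> rich)"

text \<open>With q for \<open>quarter\<close>, the weights at r of the poor vertices are at most 2q
  - 1, q - 1 and q - 1, and their sum must reach 4q - 3, so all bounds are attained. A rich
  predecessor of r would raise the required sum by 2q - 1, hence the middle vertices are not
  rich.\<close>

lemma hub_or_two:
  assumes r: "r \<in> rich" and poor: "poor = {p, q, s}" and not: "r \<notin> N q" "r \<notin> N s"
  shows "hub r p"
proof -
  have dist: "p \<noteq> q" "p \<noteq> s" "q \<noteq> s" using card3 poor by (auto simp: card_insert_if split: if_splits)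
  have pV: "p \<in> V" using poor poor_V[of p] by simp
  have le3: "card poor \<le> 3" using card3 by simp
  have sum_eq: "(\<Sum>w\<in>poor. weight k w r) = weight k p r + weight k q r + weight k s r"
    using poor dist by simp
  have base: "4 * quarter - 3 \<le> weight k p r + weight k q r + weight k s r"
    using poor_sum_ge[OF r le3, of "{}"] sum_eq by simp
  have w: "weight k p r \<le> 2 * quarter - 1" "weight k q r \<le> quarter - 1" "weight k s r \<le> quarter - 1"
    using weight_poor_le[of p r] weight_poor_le'[of q r] weight_poor_le'[of s r] r poor not by auto
  have arc: "r \<in> N p"
  proof (rule ccontr)
    assume "r \<notin> N p"
    then have "weight k p r \<le> quarter - 1" using weight_poor_le'[of p r] r poor by auto
    then show False using base w quarter_facts(3) by linarith
  qed
  have rich_pred: False if x: "x \<in> rich" "r \<in> N x" for x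
  proof -
    have "x \<noteq> r" using girth[OF rich_V[OF x(1)] x(2), of 0] k_pos by auto
    then have "4 * quarter - 3 + weight k x r \<le> weight k p r + weight k q r + weight k s r"
      using poor_sum_ge[OF r le3, of "{x}"] x sum_eq by simp
    moreover have "weight k x r = 2 * quarter - 1" using weight_arc'[OF rich_V[OF x(1)] x(2)] .
    ultimately show False using w quarter_facts(3) by linarith
  qed
  have two_steps: "\<exists>x\<in>V. x \<in> N t \<and> r \<in> N x \<and> x \<notin> rich"
    if t: "t \<in> {q, s}" for t
  proof -
    have tp: "t \<in> poor" using t poor by auto
    have "r \<in> B 2 t"
    proof (rule ccontr)
      assume "r \<notin> B 2 t"
      then have "2 * weight k t r \<le> 2 * 2 ^ (k - 3) - 2" using weight_le_3[of r t] k3 by simp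
      then have "2 * weight k t r \<le> quarter - 2" unfolding quarter_facts(4) .
      then show False using base w t quarter_facts(3) by auto
    qed
    moreover have "r \<noteq> t" using poor_rich_disjoint[OF tp] r by auto
    moreover have "r \<notin> N t" using t not by auto
    ultimately obtain x where "x \<in> N t" "r \<in> N x"
      by (auto simp: out_ball_Suc numeral_2_eq_2)
    then show ?thesis using N_in_V[OF poor_V[OF tp]] rich_pred by auto
  qed
  show ?thesis unfolding hub_def using arc two_steps poor by auto
qed

text \<open>For the other poor vertices the middle of the two-step walk is a child that is not rich.
  If p had such a child too, the outlier from \<open>outlier_into_rich\<close> would never be poor,
  so the two children of p would cover at most two of the three poor vertices.\<close>

lemma hub_into_rich:
  assumes hub: "hub r p"
  shows "N p \<subseteq> rich" "\<And>s. s \<in> poor \<Longrightarrow> s \<noteq> p \<Longrightarrow> \<not> N s \<subseteq> rich"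
proof -
  have p: "p \<in> V" using hub poor_V by (simp add: hub_def)
  show others: "\<not> N s \<subseteq> rich" if "s \<in> poor" "s \<noteq> p" for s
    using hub that unfolding hub_def by blast
  show "N p \<subseteq> rich"
  proof (rule ccontr)
    assume "\<not> N p \<subseteq> rich"
    then have none: "\<not> N s \<subseteq> rich" if "s \<in> poor" for s using others that by blast
    have small: "card (outliers u \<inter> poor) \<le> 1" if u: "u \<in> V" for u
    proof -
      obtain w where "w \<in> outliers u" "N w \<subseteq> rich" using outlier_into_rich[OF u] .
      then have "outliers u \<inter> poor \<subset> outliers u" using none by blast
      then have "card (outliers u \<inter> poor) < card (outliers u)"
        by (rule psubset_card_mono[rotated]) simp
      then show ?thesis using card_outliers_2[OF u] by simp
    qed
    obtain a b where ab: "N p = {a, b}" "a \<noteq> b" "a \<in> V" "b \<in> V" using obtain_N[OF p] .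
    have "poor = (outliers a \<inter> poor) \<union> (outliers b \<inter> poor)"
      using poor_covered[OF p ab(1)] by auto
    then have "card poor \<le> card (outliers a \<inter> poor) + card (outliers b \<inter> poor)"
      by (metis card_Un_le)
    then show False using small[OF ab(3)] small[OF ab(4)] card3 by simp
  qed
qed

text \<open>By \<open>girth\<close> a short walk between two of these vertices cannot start with
  their common child. It starts with the child shared with the third vertex, which then reaches the
  same target. By \<open>poor_dichotomy\<close>, p reaches s, so q reaches s and misses p; then s
  can reach neither p nor q.\<close>

lemma no_triangle:
  assumes poor: "poor = {p, q, s}"
    and N: "N p = {a, b}" "N q = {b, c}" "N s = {a, c}" and q: "q \<in> outliers p"
  shows False
proof -
  have V: "p \<in> V" "q \<in> V" "s \<in> V" using poor poor_V[of p] poor_V[of q] poor_V[of s] by simp_all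
  have perm: "poor = {q, p, s}" "poor = {s, p, q}" using poor by auto
  have girth': "x \<notin> B (k - 1) z" if "z \<in> N x" "x \<in> V" for x z
    using girth[OF that(2,1)] k_pos by simp
  have up: "x \<in> B k y" if "x \<in> B (k - 1) z" "z \<in> N y" for x y z
    using that by (auto simp: ball_k_iff)
  have dist: "p \<noteq> q" "p \<noteq> s" "q \<noteq> s" using card3 poor by (auto simp: card_insert_if split: if_splits)
  have "s \<in> B k p" using poor_dichotomy[OF poor] q V by (auto simp: outliers_iff)
  then have "s \<in> B (k - 1) b" using dist N girth'[of a s] V by (auto simp: ball_k_iff)
  then have "s \<in> B k q" using up N by auto
  then have pq: "p \<notin> B k q" using poor_dichotomy[OF perm(1)] V by (auto simp: outliers_iff)
  have "p \<in> B k s \<or> q \<in> B k s" using poor_dichotomy[OF perm(2)] V by (auto simp: outliers_iff)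
  then show False
  proof
    assume "p \<in> B k s"
    then have "p \<in> B (k - 1) c" using dist N girth'[of a p] V by (auto simp: ball_k_iff)
    then show False using up[of p c q] N pq by auto
  next
    assume "q \<in> B k s"
    then have "q \<in> B (k - 1) a" using dist N girth'[of c q] V by (auto simp: ball_k_iff)
    then show False using up[of q a p] N q by (auto simp: outliers_iff)
  qed
qed

lemma poor_distinct: "poor = {p, q, s} \<Longrightarrow> p \<noteq> q \<and> p \<noteq> s \<and> q \<noteq> s"
  using card3 by (auto simp: card_insert_if split: if_splits)

text \<open>The only predecessor of p is q, so s reaches q in any case, and does so through y and
  then a or b. One more step leads to p, the parent of a and b: a cycle of length at most k.\<close>

lemma no_hub_via_poor:
  assumes poor: "poor = {p, q, s}" and N: "N p = {a, b}" "N q = {c, p}" "N s = {c, y}" "N y = {a, b}"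
    and c: "c \<noteq> a" "c \<noteq> b"
  shows False
proof -
  have V: "p \<in> V" "q \<in> V" "s \<in> V" using poor poor_V[of p] poor_V[of q] poor_V[of s] by simp_all
  note dist = poor_distinct[OF poor]
  have perm: "poor = {s, p, q}" using poor by auto
  have girth': "x \<notin> B (k - 1) z" if "z \<in> N x" "x \<in> V" for x z
    using girth[OF that(2,1)] k_pos by simp
  have "card (preds p) = 1" using defect_poor[of p] poor by (simp add: defect_def)
  then obtain z where "preds p = {z}" by (rule card_1_singletonE)
  moreover have "q \<in> preds p" using N V by (simp add: preds_iff)
  ultimately have preds_p: "preds p = {q}" by simp
  have "q \<in> B k s"
  proof (rule ccontr)
    assume not: "q \<notin> B k s"
    then have "p \<in> B (Suc (k - 1)) s"
      using poor_dichotomy[OF perm] V k_pos by (auto simp: outliers_iff)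
    then obtain x where x: "x \<in> B (k - 1) s" "p \<in> N x" "x \<in> V"
      using has_parent[OF V(3), of p "k - 1"] dist k_pos by auto
    then have "x = q" using preds_p by (auto simp: preds_def)
    then show False using x(1) not in_ball_mono[of q N "k - 1" s k] by simp
  qed
  then have "q \<in> B (k - 1) c \<or> q \<in> B (k - 1) y" using dist N by (auto simp: ball_k_iff)
  then have "q \<in> B (Suc (k - 2)) y"
    using girth'[of c q] N V k3 by (simp add: Suc_diff_Suc numeral_2_eq_2)
  moreover have "q \<noteq> y" using N c by auto
  ultimately obtain d where d: "d \<in> N y" "q \<in> B (k - 2) d" by (auto simp: out_ball_Suc)
  have "p \<in> B (Suc (k - 2)) d" using out_ball_step[OF d(2)] N by simp
  then have "p \<in> B (k - 1) d" using k3 by (simp add: Suc_diff_Suc numeral_2_eq_2)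
  then show False using girth'[of d p] d(1) N V by simp
qed

lemma no_hub:
  assumes hub: "hub a p" and a: "a \<in> rich"
  shows False
proof -
  have p: "p \<in> poor" "a \<in> N p" using hub by (simp_all add: hub_def)
  have pV: "p \<in> V" using poor_V[OF p(1)] .
  have "card (poor - {p}) = 2" using card3 p(1) by simp
  then obtain q s where qs: "poor - {p} = {q, s}" "q \<noteq> s" unfolding card_2_iff by blast
  then have poor: "poor = {p, q, s}" using p(1) by auto
  have perm: "poor = {s, p, q}" "poor = {q, p, s}" "poor = {p, s, q}" using poor by auto
  note dist = poor_distinct[OF poor]
  have V: "q \<in> V" "s \<in> V" using poor poor_V[of q] poor_V[of s] by simp_all
  obtain b where b: "N p = {a, b}" "a \<noteq> b" using card_2_obtain_other[OF card_N[OF pV] p(2)] .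
  have "b \<in> rich" using hub_into_rich(1)[OF hub] b by simp
  have "card (rich - {a, b}) = 1"
    using card_rich_3 a \<open>b \<in> rich\<close> b(2) by (simp add: card_Diff_subset)
  then obtain c where "rich - {a, b} = {c}" by (rule card_1_singletonE)
  then have c: "c \<in> rich" "c \<noteq> a" "c \<noteq> b" by auto
  have not_rich: "\<not> N q \<subseteq> rich" "\<not> N s \<subseteq> rich"
    using hub_into_rich(2)[OF hub, of q] hub_into_rich(2)[OF hub, of s] poor dist by auto
  have cp: "c \<notin> N p" using b c by simp
  \<comment> \<open>If c had only one poor predecessor, that one would be a hub with only rich
    children.\<close>
  have cq: "c \<in> N q"
  proof (rule ccontr)
    assume "c \<notin> N q"
    then have "hub c s" using hub_or_two[OF c(1) perm(1) cp] by simp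
    then show False using hub_into_rich(1) not_rich(2) by blast
  qed
  have cs: "c \<in> N s"
  proof (rule ccontr)
    assume "c \<notin> N s"
    then have "hub c q" using hub_or_two[OF c(1) perm(2) cp] by simp
    then show False using hub_into_rich(1) not_rich(1) by blast
  qed
  obtain x where x: "N q = {c, x}" "c \<noteq> x" using card_2_obtain_other[OF card_N[OF V(1)] cq] .
  obtain y where y: "N s = {c, y}" "c \<noteq> y" using card_2_obtain_other[OF card_N[OF V(2)] cs] .
  have xy: "x \<notin> rich" "y \<notin> rich" using x y c(1) not_rich by auto
  have xyV: "x \<in> V" "y \<in> V" using N_in_V[OF V(1)] N_in_V[OF V(2)] x y by auto
  have via: "r \<in> N x \<and> r \<in> N y" if "hub r p" for r
  proof -
    have "\<exists>w\<in>V. w \<in> N q \<and> r \<in> N w \<and> w \<notin> rich" "\<exists>w\<in>V. w \<in> N s \<and> r \<in> N w \<and> w \<notin> rich"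
      using that poor dist unfolding hub_def by auto
    then show ?thesis using x y c(1) by auto
  qed
  have "b \<notin> N q" "b \<notin> N s" using x y xy c \<open>b \<in> rich\<close> by auto
  then have "hub b p" using hub_or_two[OF \<open>b \<in> rich\<close> poor] by simp
  then have "{a, b} \<subseteq> N x" "{a, b} \<subseteq> N y" using via hub by auto
  then have Nxy: "N x = {a, b}" "N y = {a, b}"
    using N_eqI[OF xyV(1), of a b] N_eqI[OF xyV(2), of a b] b(2) by auto
  have not_p: "x \<noteq> p" "y \<noteq> p"
  proof -
    show "x \<noteq> p" using no_hub_via_poor[OF poor b(1) _ y(1) Nxy(2) c(2,3)] x(1) by auto
    show "y \<noteq> p" using no_hub_via_poor[OF perm(3) b(1) _ x(1) Nxy(1) c(2,3)] y(1) by auto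
  qed
  have clone_poor: "w = p" if "N w = {a, b}" "w \<in> poor" for w
    using that x y c poor by (auto simp: doubleton_eq_iff)
  \<comment> \<open>Two further vertices with children a, b would be the only outliers of p, but one
    outlier of p must be poor.\<close>
  have clone_pair: False if w: "w \<in> V" "w' \<in> V" "N w = {a, b}" "N w' = {a, b}" "w \<noteq> w'" "w \<noteq> p" "w' \<noteq> p" for w w'
  proof -
    have "{w, w'} \<subseteq> outliers p"
      using clone_outlier[OF pV w(1)] clone_outlier[OF pV w(2)] w b by auto
    then have "outliers p = {w, w'}"
      using card_outliers_2[OF pV] card_seteq[of "outliers p" "{w, w'}"] w(5) by auto
    then have "w \<in> poor \<or> w' \<in> poor" using outliers_meet_poor[OF pV] by auto
    then show False using clone_poor w by blast
  qed
  show False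
  proof (cases "x = y")
    case False
    then show False using clone_pair[OF xyV Nxy _ not_p] by simp
  next
    case True
    \<comment> \<open>Now q and s are clones, so s is one outlier of q. The other, w, must precede
      both a and b, which makes w and x the forbidden pair.\<close>
    have "s \<in> outliers q" using clone_outlier[OF V] dist x y True by simp
    then have p_q: "p \<notin> outliers q" using poor_dichotomy[OF perm(2)] by simp
    obtain w where w: "outliers q = {s, w}" "s \<noteq> w"
      using card_2_obtain_other[OF card_outliers_2[OF V(1)] \<open>s \<in> outliers q\<close>] .
    have wV: "w \<in> V" using w(1) by (auto simp: outliers_def)
    have "r \<in> N w" if "r \<in> rich" "r \<noteq> c" for r
    proof -
      have "r \<notin> N s" using that xy y by auto
      then show ?thesis using rich_outlier_pred[OF V(1) that(1)] w by (auto simp: preds_iff)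
    qed
    then have "{a, b} \<subseteq> N w" using a \<open>b \<in> rich\<close> c by auto
    then have Nw: "N w = {a, b}" using N_eqI[OF wV, of a b] b(2) by simp
    have "x \<in> B (Suc 0) q" using x by (simp add: out_ball_Suc)
    then have "x \<in> B k q" using in_ball_mono[of x N "Suc 0" q k] k_pos by simp
    then have "x \<noteq> w" using w by (auto simp: outliers_def)
    moreover have "w \<noteq> p" using p_q w by auto
    ultimately show False using clone_pair[OF xyV(1) wV Nxy(1) Nw _ not_p(1)] by simp
  qed
qed

text \<open>Without hubs every rich vertex has at least two poor predecessors, while each poor
  vertex has only two children. This leaves only the triangle of \<open>no_triangle\<close>.\<close>

lemma poor_not_3: False
proof -
  obtain p q s where poor: "poor = {p, q, s}"
    using card3 by (auto simp: card_3_iff)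
  have perm: "poor = {q, p, s}" "poor = {s, p, q}" "poor = {p, s, q}" using poor by auto
  have V: "p \<in> V" "q \<in> V" "s \<in> V" using poor poor_V[of p] poor_V[of q] poor_V[of s] by simp_all
  have missed: "\<exists>r\<in>rich. r \<notin> N w" if "w \<in> V" for w
  proof (rule ccontr)
    assume "\<not> ?thesis"
    then have "rich \<subseteq> N w" by auto
    then have "card rich \<le> card (N w)" using finite_N[OF that] by (rule card_mono[rotated])
    then show False using card_N[OF that] card_rich_3 by simp
  qed
  have two: "r \<in> N x \<or> r \<in> N y" if "r \<in> rich" "poor = {w, x, y}" for r w x y
    using hub_or_two[OF that] no_hub that(1) by blast
  obtain a b c where abc: "c \<in> rich" "c \<notin> N p" "a \<in> rich" "a \<notin> N q" "b \<in> rich" "b \<notin> N s"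
    using missed V by metis
  have c: "c \<in> N q" "c \<in> N s"
    using two[OF abc(1), of s p q] two[OF abc(1), of q p s] abc perm by auto
  have a: "a \<in> N p" "a \<in> N s"
    using two[OF abc(3), of s p q] two[OF abc(3), of p q s] abc perm poor by auto
  have b: "b \<in> N p" "b \<in> N q"
    using two[OF abc(5), of q p s] two[OF abc(5), of p q s] abc perm poor by auto
  have ne: "a \<noteq> b" "a \<noteq> c" "b \<noteq> c" using a b c abc by auto
  have N: "N p = {a, b}" "N q = {b, c}" "N s = {a, c}"
    by (rule N_eqI; fact V a b c ne)+
  have N': "N p = {b, a}" "N s = {a, c}" "N q = {b, c}" using N by auto
  have "q \<in> outliers p \<or> s \<in> outliers p" using poor_dichotomy[OF poor] by blast
  then show False
    using no_triangle[OF poor N] no_triangle[OF perm(3) N'] by blast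
qed

end

lemma in_regular: assumes "v \<in> V" shows "card (preds v) = 2"
proof -
  have "card poor \<noteq> 3" using poor_not_3 by blast
  then have "card poor = 0"
    using card_poor_le_4 card_poor_neq_1 card_poor_neq_2 card_poor_neq_4 by linarith
  then have "rich = {}" using card_rich by simp
  then have "defect v = 0" using rich_nonempty[OF assms] by auto
  then show ?thesis by (simp add: defect_def)
qed

end

end

section \<open>Excess two, length two\<close>

text \<open>
  The labels enumerate the nine vertices: the root V0, its children V1 and V2, their children
  V3, V4 and V5, V6, and the two outliers V7, V8 of the root.
\<close>
datatype label = V0 | V1 | V2 | V3 | V4 | V5 | V6 | V7 | V8

definition labels :: "label list" where
  "labels = [V0, V1, V2, V3, V4, V5, V6, V7, V8]"

text \<open>
  Conjunctions and bounded quantifiers are spelled out with conditionals because symbolic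
  evaluation skips the unused branch of a conditional, but not the second argument of a conjunction.
\<close>
type_synonym arc_table = "(label \<times> label \<times> label) list"

primrec pairs :: "'b list \<Rightarrow> ('b \<times> 'b) list" where
  "pairs [] = []"
| "pairs (x # xs) = map (Pair x) xs @ pairs xs"

primrec lookup :: "arc_table \<Rightarrow> label \<Rightarrow> label list" where
  "lookup [] u = []"
| "lookup (t # T) u = (case t of (v, a, b) \<Rightarrow> if u = v then [a, b] else lookup T u)"

primrec occurs :: "label list \<Rightarrow> label \<Rightarrow> bool" where
  "occurs [] x = False"
| "occurs (y # ys) x = (if x = y then True else occurs ys x)"

primrec no_repeat :: "label list \<Rightarrow> bool" where
  "no_repeat [] = True"
| "no_repeat (x # xs) = (if occurs xs x then False else no_repeat xs)"

primrec all_of :: "('b \<Rightarrow> bool) \<Rightarrow> 'b list \<Rightarrow> bool" where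
  "all_of P [] = True"
| "all_of P (x # xs) = (if P x then all_of P xs else False)"

text \<open>\<open>lookup\<close> returns the empty list for rows still open, so a partial table is
  tested only on what is known; failure excludes every completion.\<close>

definition consistent :: "arc_table \<Rightarrow> bool" where
  "consistent T = all_of (\<lambda>(u, a, b). no_repeat (u # a # b # lookup T a @ lookup T b)) T"

primrec count_in :: "label \<Rightarrow> arc_table \<Rightarrow> nat" where
  "count_in v [] = 0"
| "count_in v (t # T) = (case t of (u, a, b) \<Rightarrow>
    if v = a then Suc (count_in v T) else if v = b then Suc (count_in v T) else count_in v T)"

primrec search :: "(label \<times> (label \<times> label) list) list \<Rightarrow> arc_table \<Rightarrow> bool" where
  "search [] T = all_of (\<lambda>v. count_in v T = 2) labels"
| "search (c # C) T = (case c of (u, ps) \<Rightarrow> all_of (\<lambda>(a, b).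
     if consistent ((u, a, b) # T) then search C ((u, a, b) # T) else True) ps)"

definition candidates :: "label list \<Rightarrow> (label \<times> label) list" where
  "candidates xs = pairs (filter (\<lambda>x. \<not> occurs xs x) labels)"

text \<open>The exclusions are geodecity at V1 and at V2. The rows of V7 and V8 exclude only
  loops.\<close>

definition tasks :: "(label \<times> (label \<times> label) list) list" where
  "tasks = [(V3, candidates [V1, V3, V4]), (V4, candidates [V1, V3, V4]),
    (V5, candidates [V2, V5, V6]), (V6, candidates [V2, V5, V6]),
    (V7, candidates [V7]), (V8, candidates [V8])]"

lemma search_succeeds: "search tasks [(V2, V5, V6), (V1, V3, V4), (V0, V1, V2)]"
  by code_simp

section \<open>Soundness of the search\<close>

lemma occurs_iff [simp]: "occurs ys x \<longleftrightarrow> x \<in> set ys"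
  by (induction ys) auto

lemma no_repeat_iff [simp]: "no_repeat xs \<longleftrightarrow> distinct xs"
  by (induction xs) auto

lemma all_of_iff [simp]: "all_of P xs \<longleftrightarrow> (\<forall>x\<in>set xs. P x)"
  by (induction xs) auto

lemma in_labels [simp]: "x \<in> set labels"
  by (cases x) (simp_all add: labels_def)

lemma set_pairs_filter: "set (pairs (filter P xs)) = {(a, b) \<in> set (pairs xs). P a \<and> P b}"
  by (induction xs) auto

lemma pairs_total:
  "a \<in> set xs \<Longrightarrow> b \<in> set xs \<Longrightarrow> a \<noteq> b \<Longrightarrow> (a, b) \<in> set (pairs xs) \<or> (b, a) \<in> set (pairs xs)"
  by (induction xs) auto

lemma count_in_eq: "count_in v T = length (filter (\<lambda>(u, a, b). v = a \<or> v = b) T)"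
  by (induction T) (auto split: if_splits)

context
  fixes f :: "label \<Rightarrow> label \<times> label"
begin

definition children :: "label \<Rightarrow> label list" where
  "children u = [fst (f u), snd (f u)]"

lemma lookup_children:
  "\<forall>(v, p)\<in>set T. f v = p \<Longrightarrow> lookup T u = [] \<or> lookup T u = children u"
  by (induction T) (auto simp: children_def split: if_splits)

context
  assumes geo: "\<And>u. distinct (u # children u @ concat (map children (children u)))"
begin

lemma consistent_if_tabulates:
  assumes T: "\<forall>(v, p)\<in>set T. f v = p" shows "consistent T"
  unfolding consistent_def all_of_iff no_repeat_iff
proof clarify
  fix u a b assume "(u, a, b) \<in> set T"
  then have "children u = [a, b]" using T by (auto simp: children_def)
  then have "distinct (u # a # b # children a @ children b)" using geo[of u] by simp
  then show "distinct (u # a # b # lookup T a @ lookup T b)"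
    using lookup_children[OF T, of a] lookup_children[OF T, of b] by (elim disjE) simp_all
qed

text \<open>At each task the true row \<open>f u\<close> is among the candidates and keeps the table
  consistent, so the search runs through the table of f down to the in-degree test.\<close>

lemma search_sound:
  assumes "search C T" "\<forall>(v, p)\<in>set T. f v = p" "\<forall>(u, ps)\<in>set C. f u \<in> set ps"
  shows "count_in v (rev (map (\<lambda>c. (fst c, f (fst c))) C) @ T) = 2"
  using assms
proof (induction C arbitrary: T)
  case (Cons c C)
  obtain u ps where c: "c = (u, ps)" by (cases c)
  obtain a b where ab: "f u = (a, b)" by (cases "f u")
  let ?T = "(u, a, b) # T"
  have tab: "\<forall>(v, p)\<in>set ?T. f v = p" using Cons.prems(2) ab by auto
  have "(a, b) \<in> set ps" using Cons.prems(3) c ab by auto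
  moreover have "\<forall>x\<in>set ps. case x of (a, b) \<Rightarrow>
      if consistent ((u, a, b) # T) then search C ((u, a, b) # T) else True"
    using Cons.prems(1) c by simp
  ultimately have "search C ?T"
    using consistent_if_tabulates[OF tab] by auto
  then have "count_in v (rev (map (\<lambda>c. (fst c, f (fst c))) C) @ ?T) = 2"
    using Cons.IH[OF _ tab] Cons.prems(3) by simp
  then show ?case using c ab by simp
qed simp

lemma label_in_degree:
  assumes pairs: "\<And>u. f u \<in> set (pairs labels)"
    and f: "f V0 = (V1, V2)" "f V1 = (V3, V4)" "f V2 = (V5, V6)"
  shows "card {u. v \<in> set (children u)} = 2"
proof -
  have cand: "f u \<in> set (candidates xs)" if "set (children u) \<inter> set xs = {}" for u xs
    using pairs[of u] that by (auto simp: candidates_def set_pairs_filter children_def split_beta)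
  have "children V0 = [V1, V2]" "children V1 = [V3, V4]" "children V2 = [V5, V6]"
    by (simp_all add: children_def f)
  then have "\<forall>(u, ps)\<in>set tasks. f u \<in> set ps"
    using geo[of V1] geo[of V2] geo[of V7] geo[of V8] by (auto simp: tasks_def intro!: cand)
  then have "count_in v (rev (map (\<lambda>c. (fst c, f (fst c))) tasks) @ [(V2, V5, V6), (V1, V3, V4), (V0, V1, V2)]) = 2"
    using f by (intro search_sound search_succeeds) auto
  also have "rev (map (\<lambda>c. (fst c, f (fst c))) tasks) @ [(V2, V5, V6), (V1, V3, V4), (V0, V1, V2)]
      = map (\<lambda>u. (u, f u)) (rev labels)"
    by (simp add: tasks_def labels_def f)
  also have "count_in v \<dots> = length (filter (\<lambda>u. v \<in> set (children u)) (rev labels))"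
    by (simp add: count_in_eq filter_map comp_def split_beta children_def)
  also have "\<dots> = card {u. v \<in> set (children u)}"
  proof -
    have "distinct (rev labels)" by (simp add: labels_def)
    moreover have "set (rev labels) = UNIV" by auto
    ultimately show ?thesis by (simp only: distinct_length_filter Int_UNIV_right)
  qed
  finally show ?thesis .
qed

end

end

section \<open>Labelling a digraph of order 9\<close>

context binary_geodetic
begin

lemma in_regular_2:
  assumes k: "k = 2" and order: "card V = 9" and v: "v \<in> V"
  shows "card (preds v) = 2"
proof -
  obtain x1 x2 where 0: "N v = {x1, x2}" "x1 \<in> V" "x2 \<in> V" using obtain_N[OF v] .
  obtain x3 x4 where 1: "N x1 = {x3, x4}" "x3 \<in> V" "x4 \<in> V" using obtain_N[OF 0(2)] .
  obtain x5 x6 where 2: "N x2 = {x5, x6}" "x5 \<in> V" "x6 \<in> V" using obtain_N[OF 0(3)] .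
  have "card (outliers v) = 2" using card_outliers[OF v] order k by simp
  then obtain x7 x8 where 3: "outliers v = {x7, x8}" unfolding card_2_iff by blast
  then have 4: "x7 \<in> V" "x8 \<in> V" by (auto simp: outliers_def)
  \<comment> \<open>The vertex v takes the root label V0, so the in-degree of the root
    decides.\<close>
  define \<phi> where "\<phi> = case_label v x1 x2 x3 x4 x5 x6 x7 x8"
  have \<phi>: "\<phi> V0 = v" "\<phi> V1 = x1" "\<phi> V2 = x2" "\<phi> V3 = x3" "\<phi> V4 = x4" "\<phi> V5 = x5"
      "\<phi> V6 = x6" "\<phi> V7 = x7" "\<phi> V8 = x8"
    by (simp_all add: \<phi>_def)
  have UNIV: "(UNIV :: label set) = set labels" by auto
  have in_V: "\<phi> u \<in> V" for u using v 0 1 2 4 by (cases u) (simp_all add: \<phi>)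
  have B2: "B k u = B 2 u" for u by (simp only: k)
  have "V \<subseteq> B 2 v \<union> {x7, x8}" unfolding 3[symmetric] B2[symmetric] by (auto simp: outliers_def)
  also have "\<dots> = \<phi> ` set labels"
    by (auto simp: labels_def \<phi> 0 1 2 out_ball_Suc numeral_2_eq_2)
  finally have range: "range \<phi> = V" using in_V UNIV by auto
  have card9: "card (UNIV :: label set) = 9" unfolding UNIV by (simp add: labels_def)
  then have fin: "finite (UNIV :: label set)" by (rule card_ge_0_finite[OF ord_less_eq_trans[rotated, OF sym]]) simp
  have inj: "inj \<phi>"
    using fin card9 range order by (intro eq_card_imp_inj_on) auto
  have "\<exists>p. p \<in> set (pairs labels) \<and> N (\<phi> u) = {\<phi> (fst p), \<phi> (snd p)}" for u
  proof -
    obtain y z where yz: "N (\<phi> u) = {y, z}" "y \<noteq> z" "y \<in> V" "z \<in> V" using obtain_N[OF in_V] .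
    then obtain a b where ab: "y = \<phi> a" "z = \<phi> b" using range by blast
    then have "(a, b) \<in> set (pairs labels) \<or> (b, a) \<in> set (pairs labels)"
      using yz(2) by (intro pairs_total) auto
    then show ?thesis using yz(1) ab by (metis fst_conv insert_commute snd_conv)
  qed
  then obtain f where f: "\<And>u. f u \<in> set (pairs labels)" "\<And>u. N (\<phi> u) = {\<phi> (fst (f u)), \<phi> (snd (f u))}"
    by metis
  have N_children: "N (\<phi> u) = \<phi> ` set (children f u)" for u
    using f(2)[of u] by (simp add: children_def)
  \<comment> \<open>The ball of radius 2 has 7 vertices, as many as the list has entries, so no
    entry repeats.\<close>
  have geo: "distinct (u # children f u @ concat (map (children f) (children f u)))" for u
  proof (rule card_distinct)
    let ?L = "u # children f u @ concat (map (children f) (children f u))"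
    have "B 2 (\<phi> u) = \<phi> ` set ?L"
      by (auto simp: out_ball_Suc numeral_2_eq_2 N_children)
    then have "card (set ?L) = card (B 2 (\<phi> u))"
      using card_image[OF inj_on_subset[OF inj subset_UNIV], of "set ?L"] by (simp only:)
    then show "card (set ?L) = length ?L"
      using card_ball_k[OF in_V[of u]] k by (simp add: children_def)
  qed
  have root: "f u = (a, b)" if "N (\<phi> u) = {\<phi> a, \<phi> b}" "(b, a) \<notin> set (pairs labels)" for u a b
  proof -
    have "\<phi> ` {fst (f u), snd (f u)} = \<phi> ` {a, b}" using that(1) f(2)[of u] by simp
    then have "{fst (f u), snd (f u)} = {a, b}" using inj by (simp only: inj_image_eq_iff)
    then show ?thesis using f(1)[of u] that(2) by (cases "f u") (auto simp: doubleton_eq_iff)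
  qed
  have "f V0 = (V1, V2)" "f V1 = (V3, V4)" "f V2 = (V5, V6)"
    by (rule root; simp add: \<phi> 0 1 2 labels_def)+
  then have "card {u. V0 \<in> set (children f u)} = 2"
    using label_in_degree[of f, OF geo f(1)] by simp
  moreover have "preds v = \<phi> ` {u. V0 \<in> set (children f u)}"
  proof -
    have "v \<in> N (\<phi> u) \<longleftrightarrow> V0 \<in> set (children f u)" for u
      using inj \<phi>(1) by (auto simp: N_children inj_image_mem_iff simp flip: \<phi>(1))
    then show ?thesis using range by (auto simp: preds_def)
  qed
  ultimately show ?thesis using inj by (simp add: card_image inj_on_subset)
qed

end

section \<open>Digraphs as arc sets\<close>

lemma moore_bound_2: "Suc (moore_bound 2 k) = 2 ^ Suc k"
  by (induction k) (simp_all add: moore_bound_def)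

definition succs :: "('a, 'b) pre_digraph \<Rightarrow> 'a \<Rightarrow> 'a set" where
  "succs G u = head G ` out_arcs G u"

section \<open>From arc walks to successor sets\<close>

context fin_digraph
begin

lemma succs_subset: "succs G u \<subseteq> verts G"
  by (auto simp: succs_def)

lemma awalk_Cons: "e \<in> out_arcs G u \<Longrightarrow> awalk (head G e) p v \<Longrightarrow> awalk u (e # p) v"
  by (auto simp: awalk_def)

lemma in_out_ball_awalk:
  "u \<in> verts G \<Longrightarrow> x \<in> out_ball (succs G) m u \<Longrightarrow> \<exists>p. awalk u p x \<and> length p \<le> m"
proof (induction m arbitrary: u)
  case 0
  then show ?case by (auto simp: awalk_def intro!: exI[of _ "[]"])
next
  case (Suc m)
  show ?case
  proof (cases "x = u")
    case True
    then show ?thesis using Suc.prems by (auto simp: awalk_def intro!: exI[of _ "[]"])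
  next
    case False
    then obtain v where v: "v \<in> succs G u" "x \<in> out_ball (succs G) m v"
      using Suc.prems(2) by (auto simp: out_ball_Suc)
    then obtain e where e: "e \<in> out_arcs G u" "x \<in> out_ball (succs G) m (head G e)"
      by (auto simp: succs_def[of G u])
    then obtain p where "awalk (head G e) p x" "length p \<le> m"
      using Suc.IH[of "head G e"] by auto
    then show ?thesis using awalk_Cons[OF e(1)] by (intro exI[of _ "e # p"]) auto
  qed
qed

context
  fixes k
  assumes geo: "k_geodetic k G" and k_pos: "0 < k"
begin

lemma unique_walk:
  assumes "u \<in> verts G" "awalk u p v" "awalk u q v" "length p \<le> k" "length q \<le> k"
  shows "p = q"
proof -
  have "v \<in> verts G" using assms(2) by (rule awalk_last_in_verts)
  then show ?thesis using geo assms unfolding k_geodetic_def by blast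
qed

lemma no_parallel:
  assumes "e \<in> arcs G" "e' \<in> arcs G" "tail G e = tail G e'" "head G e = head G e'"
  shows "e = e'"
proof -
  have "awalk (tail G e) [e] (head G e)" "awalk (tail G e) [e'] (head G e)"
    using assms by (auto simp: awalk_def)
  then have "[e] = [e']" using unique_walk[of "tail G e" "[e]" "head G e" "[e']"] assms(1) k_pos by simp
  then show ?thesis by simp
qed

lemma card_succs: "card (succs G u) = out_degree G u"
  unfolding succs_def out_degree_def using no_parallel by (intro card_image) (auto simp: inj_on_def)

lemma in_degree_eq: "in_degree G v = card {x \<in> verts G. v \<in> succs G x}"
proof -
  have "tail G ` in_arcs G v = {x \<in> verts G. v \<in> succs G x}"
    by (auto simp: succs_def)
  moreover have "inj_on (tail G) (in_arcs G v)"
    using no_parallel by (auto simp: inj_on_def)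
  ultimately show ?thesis unfolding in_degree_def by (metis card_image)
qed

text \<open>A walk back to u would compete with the empty walk.\<close>

lemma succs_girth:
  assumes "u \<in> verts G" "v \<in> succs G u" "m < k" shows "u \<notin> out_ball (succs G) m v"
proof
  assume "u \<in> out_ball (succs G) m v"
  moreover obtain e where e: "e \<in> out_arcs G u" "v = head G e" using assms(2) by (auto simp: succs_def)
  ultimately obtain p where p: "awalk v p u" "length p \<le> m"
    using in_out_ball_awalk[of v u m] by auto
  have "awalk u [] u" using assms(1) by (simp add: awalk_def)
  then show False
    using unique_walk[OF assms(1) awalk_Cons[OF e(1)], of p u "[]"] p e(2) assms(3) by simp
qed

lemma succs_disjoint:
  assumes "u \<in> verts G" "v \<in> succs G u" "w \<in> succs G u" "v \<noteq> w" "m < k"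
  shows "out_ball (succs G) m v \<inter> out_ball (succs G) m w = {}"
proof (rule ccontr)
  assume "\<not> ?thesis"
  then obtain x where x: "x \<in> out_ball (succs G) m v" "x \<in> out_ball (succs G) m w" by auto
  obtain e where e: "e \<in> out_arcs G u" "v = head G e" using assms(2) by (auto simp: succs_def)
  obtain e' where e': "e' \<in> out_arcs G u" "w = head G e'" using assms(3) by (auto simp: succs_def)
  obtain p where p: "awalk v p x" "length p \<le> m" using in_out_ball_awalk[of v x m] x e by auto
  obtain q where q: "awalk w q x" "length q \<le> m" using in_out_ball_awalk[of w x m] x e' by auto
  have "e # p = e' # q"
    using unique_walk[OF assms(1) awalk_Cons[OF e(1)] awalk_Cons[OF e'(1)], of p x q] p q e e' assms(5)
    by simp
  then show False using e e' assms(4) by simp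
qed

lemma out_ball_subset_verts: "u \<in> verts G \<Longrightarrow> out_ball (succs G) m u \<subseteq> verts G"
  using in_out_ball_awalk awalk_last_in_verts by blast

lemma card_out_ball_Suc:
  assumes u: "u \<in> verts G" and m: "m < k"
  shows "card (out_ball (succs G) (Suc m) u) = Suc (\<Sum>v\<in>succs G u. card (out_ball (succs G) m v))"
proof -
  have "finite (out_ball (succs G) m v)" if "v \<in> succs G u" for v
    using finite_subset[OF out_ball_subset_verts finite_verts] succs_subset that by blast
  moreover have "finite (succs G u)" using succs_subset finite_verts by (rule finite_subset)
  ultimately have "card (\<Union>v\<in>succs G u. out_ball (succs G) m v) = (\<Sum>v\<in>succs G u. card (out_ball (succs G) m v))"
    using succs_disjoint[OF u _ _ _ m] by (intro card_UN_disjoint) simp_all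
  moreover have "u \<notin> (\<Union>v\<in>succs G u. out_ball (succs G) m v)"
    using succs_girth[OF u _ m] by blast
  moreover have "(\<Union>v\<in>succs G u. out_ball (succs G) m v) \<subseteq> verts G"
    using succs_subset out_ball_subset_verts by blast
  then have "finite (\<Union>v\<in>succs G u. out_ball (succs G) m v)"
    using finite_verts by (rule finite_subset)
  ultimately show ?thesis by (simp add: out_ball_Suc)
qed

section \<open>Out-regularity from the order\<close>

context
  assumes min_out: "\<And>u. u \<in> verts G \<Longrightarrow> 2 \<le> out_degree G u"
begin

lemma card_out_ball_ge: "u \<in> verts G \<Longrightarrow> m \<le> k \<Longrightarrow> 2 ^ Suc m \<le> Suc (card (out_ball (succs G) m u))"
proof (induction m arbitrary: u)
  case (Suc m)
  have "2 * (2 ^ Suc m - 1) \<le> card (succs G u) * (2 ^ Suc m - 1)"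
    using min_out[OF Suc.prems(1)] by (intro mult_right_mono) (simp_all add: card_succs)
  also have "\<dots> = (\<Sum>v\<in>succs G u. 2 ^ Suc m - 1)" by simp
  also have "\<dots> \<le> (\<Sum>v\<in>succs G u. card (out_ball (succs G) m v))"
  proof (rule sum_mono)
    fix v assume "v \<in> succs G u"
    then have "2 ^ Suc m \<le> Suc (card (out_ball (succs G) m v))"
      using Suc.IH[of v] Suc.prems(2) succs_subset by auto
    then show "2 ^ Suc m - 1 \<le> card (out_ball (succs G) m v)" by simp
  qed
  finally show ?case using card_out_ball_Suc[OF Suc.prems(1), of m] Suc.prems(2) by simp
qed simp

text \<open>A third child would force at least 1 + 3(2^k - 1) vertices, more than 2 * 2^k + 1 once
  2^k >= 4.\<close>

lemma out_regular:
  assumes k2: "2 \<le> k" and order: "card (verts G) = 2 ^ Suc k + 1" and u: "u \<in> verts G"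
  shows "out_degree G u = 2"
proof (rule ccontr)
  assume "out_degree G u \<noteq> 2"
  then have "3 \<le> card (succs G u)" using min_out[OF u] by (simp add: card_succs)
  then have "3 * (2 ^ k - 1) \<le> card (succs G u) * (2 ^ k - 1)"
    by (intro mult_right_mono) simp_all
  also have "\<dots> = (\<Sum>v\<in>succs G u. 2 ^ k - 1)" by simp
  also have "\<dots> \<le> (\<Sum>v\<in>succs G u. card (out_ball (succs G) (k - 1) v))"
  proof (rule sum_mono)
    fix v assume "v \<in> succs G u"
    then have "2 ^ Suc (k - 1) \<le> Suc (card (out_ball (succs G) (k - 1) v))"
      using card_out_ball_ge[of v "k - 1"] succs_subset by auto
    then show "2 ^ k - 1 \<le> card (out_ball (succs G) (k - 1) v)" using k_pos by simp
  qed
  also have "\<dots> < card (out_ball (succs G) k u)"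
    using card_out_ball_Suc[OF u, of "k - 1"] k_pos by simp
  also have "\<dots> \<le> card (verts G)"
    using out_ball_subset_verts[OF u] by (intro card_mono) simp_all
  finally have "3 * (2 ^ k - 1) \<le> (2::nat) * 2 ^ k" using order by simp
  moreover have "(2::nat) ^ 2 \<le> 2 ^ k" using k2 by (intro power_increasing) simp_all
  ultimately show False by simp
qed

lemma binary_geodetic_succs:
  assumes "2 \<le> k" "card (verts G) = 2 ^ Suc k + 1"
  shows "binary_geodetic (verts G) (succs G) k"
proof
  note out2 = out_regular[OF assms]
  show "finite (verts G)" "0 < k" using k_pos by simp_all
  fix u assume u: "u \<in> verts G"
  show "succs G u \<subseteq> verts G" by (rule succs_subset)
  show "card (succs G u) = 2" using out2[OF u] by (simp add: card_succs)
  have "card (out_ball (succs G) m u) = 2 ^ Suc m - 1" if "m \<le> k" "u \<in> verts G" for m u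
    using that
  proof (induction m arbitrary: u)
    case (Suc m)
    have "(\<Sum>v\<in>succs G u. card (out_ball (succs G) m v)) = (\<Sum>v\<in>succs G u. 2 ^ Suc m - 1)"
      using Suc succs_subset by (intro sum.cong) auto
    also have "\<dots> = 2 * (2 ^ Suc m - 1)" using out2[OF Suc.prems(2)] by (simp add: card_succs)
    finally show ?case
      using card_out_ball_Suc[OF Suc.prems(2), of m] Suc.prems(1) by (cases "2 ^ m :: nat") simp_all
  qed simp
  then show "card (out_ball (succs G) k u) = 2 ^ Suc k - 1" using u by simp
qed

end

end

end

theorem mainTheorem1:
  fixes k :: nat
  assumes "k \<ge> 2"
  shows "\<not> (\<exists>G :: ('a, 'b) pre_digraph. excess_digraph 2 k 2 G \<and> \<not> diregular G)"
proof clarify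
  fix G :: "('a, 'b) pre_digraph"
  assume excess: "excess_digraph 2 k 2 G" and irregular: "\<not> diregular G"
  interpret fin_digraph G using excess by (simp add: excess_digraph_def)
  have geo: "k_geodetic k G" and min_out: "\<And>u. u \<in> verts G \<Longrightarrow> 2 \<le> out_degree G u"
    and order: "card (verts G) = 2 ^ Suc k + 1"
    using excess moore_bound_2[of k] by (simp_all add: excess_digraph_def)
  have k_pos: "0 < k" using assms by simp
  interpret binary_geodetic "verts G" "succs G" k
    by (rule binary_geodetic_succs[OF geo k_pos min_out assms order])
  have "card (preds v) = 2" if "v \<in> verts G" for v
  proof (cases "k = 2")
    case True
    then show ?thesis using in_regular_2 that order by simp
  next
    case False
    then show ?thesis using in_regular[OF _ _ that] assms order by simp
  qed
  then have "in_degree G v = 2 \<and> out_degree G v = 2" if "v \<in> verts G" for v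
    using that in_degree_eq[OF geo k_pos] out_regular[OF geo k_pos min_out assms order]
    by (simp add: preds_def)
  then show False using irregular unfolding diregular_def by blast
qed

end
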